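(* Let $(p, p', q) \in \mathbb{N}^3$ satisfy $p = 2p' + 1$, $1 < q \leq p'$ and $\gcd(q, p) = 1$, with $p$ prime. Then there exists a Toeplitz subshift $X \subset S^{\mathbb{Z}}$ (for some finite alphabet $S$) whose endomorphism monoid is isomorphic to the group \[ A(p, q) = \left\langle \left(\frac{p}{q}\right)^i \;\middle|\; i \in \mathbb{N} \right\rangle \leq (\mathbb{Q}, +). \]
   Context: Let $S$ be a finite alphabet with the discrete topology and give $S^{\mathbb{Z}}$ the product topology. The shift map is $\sigma(x)_i = x_{i+1}$. A subshift is a topologically closed $X \subset S^{\mathbb{Z}}$ with $\sigma(X) = X$. A Toeplitz point is $x \in S^{\mathbb{Z}}$ such that for every $i \in \mathbb{Z}$ there is $r > 0$ with $x_{i+kr} = x_i$ for all $k \in \mathbb{Z}$. A Toeplitz subshift is the orbit closure $\overline{\{\sigma^i(x) \mid i \in \mathbb{Z}\}}$ of a Toeplitz point $x$. An endomorphism of a subshift $X$ is a continuous map $f : X \to X$ with $f \circ \sigma = \sigma \circ f$. The endomorphisms form a monoid under composition, the endomorphism monoid of $X$. Here $0 \in \mathbb{N}$. *)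

theory Defs
  imports "HOL-Analysis.Analysis" "HOL-Algebra.Elementary_Groups"
begin

text \<open>
  Finite alphabets are finite sets of natural numbers; up to renaming of symbols this covers all
  finite alphabets and lets the alphabet be quantified existentially.
\<close>

definition full_shift :: "nat set \<Rightarrow> (int \<Rightarrow> nat) topology" where
  "full_shift S = product_topology (\<lambda>_. discrete_topology S) UNIV"

definition shift :: "(int \<Rightarrow> nat) \<Rightarrow> (int \<Rightarrow> nat)" where
  "shift x = (\<lambda>i. x (i + 1))"

text \<open>The integer powers of the shift; the first three lemmas below justify this reading.\<close>

definition shift_pow :: "int \<Rightarrow> (int \<Rightarrow> nat) \<Rightarrow> (int \<Rightarrow> nat)" where
  "shift_pow k x = (\<lambda>i. x (i + k))"

definition subshift :: "nat set \<Rightarrow> (int \<Rightarrow> nat) set \<Rightarrow> bool" where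
  "subshift S X \<longleftrightarrow> closedin (full_shift S) X \<and> shift ` X = X"

definition toeplitz_point :: "nat set \<Rightarrow> (int \<Rightarrow> nat) \<Rightarrow> bool" where
  "toeplitz_point S x \<longleftrightarrow> x \<in> topspace (full_shift S) \<and>
     (\<forall>i. \<exists>r>0. \<forall>k. x (i + k * r) = x i)"

definition toeplitz_subshift :: "nat set \<Rightarrow> (int \<Rightarrow> nat) set \<Rightarrow> bool" where
  "toeplitz_subshift S X \<longleftrightarrow>
     (\<exists>x. toeplitz_point S x \<and> X = full_shift S closure_of (range (\<lambda>i. shift_pow i x)))"

text \<open>Endomorphisms are taken to be extensional, so that each map on \<open>X\<close> is represented once.\<close>

definition endo_monoid ::
    "nat set \<Rightarrow> (int \<Rightarrow> nat) set \<Rightarrow> ((int \<Rightarrow> nat) \<Rightarrow> (int \<Rightarrow> nat)) monoid" where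
  "endo_monoid S X =
     \<lparr>carrier = {f \<in> X \<rightarrow>\<^sub>E X.
        continuous_map (subtopology (full_shift S) X) (subtopology (full_shift S) X) f \<and>
        (\<forall>x\<in>X. f (shift x) = shift (f x))},
      monoid.mult = (\<lambda>f g. compose X f g),
      one = (\<lambda>x\<in>X. x)\<rparr>"

definition rat_add_group :: "rat monoid" where
  "rat_add_group = \<lparr>carrier = UNIV, monoid.mult = (+), one = 0\<rparr>"

definition A_group :: "nat \<Rightarrow> nat \<Rightarrow> rat monoid" where
  "A_group p q =
     subgroup_generated rat_add_group (range (\<lambda>i::nat. (of_nat p / of_nat q) ^ i))"

lemma shift_pow_0: "shift_pow 0 x = x"
  by (simp add: shift_pow_def)

lemma shift_pow_1: "shift_pow 1 = shift"
  by (simp add: shift_pow_def shift_def fun_eq_iff)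

lemma shift_pow_add: "shift_pow (k + l) x = shift_pow k (shift_pow l x)"
  by (simp add: shift_pow_def fun_eq_iff algebra_simps)

lemma topspace_full_shift: "topspace (full_shift S) = {x. range x \<subseteq> S}"
  by (auto simp: full_shift_def PiE_iff)

lemma continuous_map_shift_pow:
  "continuous_map (full_shift S) (full_shift S) (shift_pow k)"
  unfolding full_shift_def shift_pow_def
  by (subst continuous_map_componentwise) (auto intro: continuous_map_product_projection)

lemma homeomorphic_map_shift: "homeomorphic_map (full_shift S) (full_shift S) shift"
proof -
  have "homeomorphic_maps (full_shift S) (full_shift S) (shift_pow 1) (shift_pow (- 1))"
    unfolding homeomorphic_maps_def
    by (simp add: continuous_map_shift_pow flip: shift_pow_add) (simp add: shift_pow_0)
  then show ?thesis
    unfolding shift_pow_1 by (rule homeomorphic_maps_imp_map)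
qed

lemma shift_orbit: "shift ` range (\<lambda>i. shift_pow i x) = range (\<lambda>i. shift_pow i x)"
proof -
  have "shift ` range (\<lambda>i. shift_pow i x) = (\<lambda>i. shift_pow i x) ` range (\<lambda>i. 1 + i)"
    by (simp only: image_image shift_pow_add flip: shift_pow_1)
  also have "range (\<lambda>i::int. 1 + i) = UNIV"
    by (simp add: surj_plus)
  finally show ?thesis .
qed

lemma toeplitz_subshift_imp_subshift:
  assumes "toeplitz_subshift S X"
  shows "subshift S X"
proof -
  obtain x where x: "x \<in> topspace (full_shift S)"
    and X: "X = full_shift S closure_of (range (\<lambda>i. shift_pow i x))"
    using assms by (auto simp: toeplitz_subshift_def toeplitz_point_def)
  have "range (\<lambda>i. shift_pow i x) \<subseteq> topspace (full_shift S)"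
    using x by (auto simp: topspace_full_shift shift_pow_def)
  then have "shift ` X = X"
    using homeomorphic_map_closure_of[OF homeomorphic_map_shift] by (metis X shift_orbit)
  then show ?thesis
    by (simp add: subshift_def X)
qed

lemma monoid_endo_monoid:
  assumes "subshift S X"
  shows "monoid (endo_monoid S X)"
proof -
  have sh: "shift x \<in> X" if "x \<in> X" for x
    using assms that by (auto simp: subshift_def)
  have top: "topspace (subtopology (full_shift S) X) = X"
    using assms by (auto simp: subshift_def dest: closedin_subset)
  let ?T = "subtopology (full_shift S) X"
  have comp: "continuous_map ?T ?T (compose X f g)"
    if "continuous_map ?T ?T f" "continuous_map ?T ?T g" for f g
    using continuous_map_compose[OF that(2,1)]
    by (rule continuous_map_eq) (simp add: top compose_def)
  have ident: "continuous_map ?T ?T (\<lambda>x\<in>X. x)"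
    using continuous_map_id[of ?T] by (rule continuous_map_eq) (simp add: top)
  show ?thesis
  proof (unfold_locales, goal_cases)
    case (1 f g)
    then show ?case
      by (auto simp: endo_monoid_def comp sh compose_eq PiE_iff Pi_iff)
  next
    case (2 f g h)
    then show ?case
      by (auto simp: endo_monoid_def compose_def fun_eq_iff dest: PiE_mem)
  next
    case 3
    then show ?case
      by (auto simp: endo_monoid_def ident sh)
  next
    case (4 f)
    then show ?case
      by (auto simp: endo_monoid_def PiE_iff Pi_iff intro!: Id_compose)
  next
    case (5 f)
    then show ?case
      by (auto simp: endo_monoid_def PiE_iff Pi_iff intro!: compose_Id)
  qed
qed

lemma comm_group_rat_add_group: "comm_group rat_add_group"
  by (rule comm_groupI) (auto simp: rat_add_group_def intro: exI[of _ "- x" for x])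

end

theory Submission
  imports Defs
begin

text \<open>
  The Toeplitz point is the fixed point \<open>base\<close> of \<open>fill\<close>: each block of length \<open>p\<close> has \<open>q\<close> isolated
  holes, at the positions \<open>1, 3, \<dots>, 2 q - 1\<close>, which successively receive the next \<open>q\<close> symbols of the
  filling sequence; all other positions carry their residue modulo \<open>p\<close>, so the phase of a point is
  visible. Every endomorphism \<open>f\<close> satisfies \<open>f (fill y) = \<sigma>\<^sup>c (fill (g y))\<close> for some endomorphism \<open>g\<close>, and
  since the holes are isolated, \<open>g\<close> has a window about half as long as that of \<open>f\<close>. Iterating leads to
  a window of one position, where only shifts remain. As \<open>\<sigma>\<^sup>q\<close> on the filling sequence is \<open>\<sigma>\<^sup>p\<close> on the
  filled one, passing from \<open>g\<close> to \<open>f\<close> is \<open>r \<mapsto> c + (p / q) r\<close> on \<open>\<rat>\<close>, the shift being \<open>1\<close>.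
\<close>

section \<open>Cylinder neighbourhoods in the full shift\<close>

lemma shift_pow_apply [simp]: "shift_pow k x i = x (i + k)"
  by (simp add: shift_pow_def)

lemma shift_pow_inverse [simp]:
  "shift_pow (- k) (shift_pow k x) = x" "shift_pow k (shift_pow (- k) x) = x"
  by (simp_all add: fun_eq_iff)

lemma shift_pow_eq_iff [simp]: "shift_pow k x = shift_pow k y \<longleftrightarrow> x = y"
  by (metis shift_pow_inverse(1))

definition agree :: "int \<Rightarrow> (int \<Rightarrow> nat) \<Rightarrow> (int \<Rightarrow> nat) \<Rightarrow> bool" where
  "agree N x y \<longleftrightarrow> (\<forall>i. \<bar>i\<bar> \<le> N \<longrightarrow> x i = y i)"

lemma agreeD: "agree N x y \<Longrightarrow> \<bar>i\<bar> \<le> N \<Longrightarrow> x i = y i"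
  by (simp add: agree_def)

lemma agree_sym: "agree N x y \<Longrightarrow> agree N y x"
  by (simp add: agree_def)

lemma agree_trans: "agree N x y \<Longrightarrow> agree N y z \<Longrightarrow> agree N x z"
  by (simp add: agree_def)

lemma agree_mono: "agree N x y \<Longrightarrow> M \<le> N \<Longrightarrow> agree M x y"
  by (simp add: agree_def)

lemma agree_shift_pow: "agree (N + \<bar>k\<bar>) x y \<Longrightarrow> agree N (shift_pow k x) (shift_pow k y)"
  unfolding agree_def by (smt (verit) shift_pow_apply)

lemma agree_imp_eq: "(\<And>N. agree N x y) \<Longrightarrow> x = y"
  unfolding agree_def by force

text \<open>Only the finitely many coordinates in \<open>{- N..N}\<close> are constrained. Together
  with the next lemma this reduces the topology to \<open>agree\<close>.\<close>

lemma openin_full_shift_agree: "openin (full_shift S) {y \<in> topspace (full_shift S). agree N x y}"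
proof -
  let ?C = "\<lambda>i. if \<bar>i\<bar> \<le> N then S \<inter> {x i} else S"
  have "{y \<in> topspace (full_shift S). agree N x y} = Pi\<^sub>E UNIV ?C"
    unfolding topspace_full_shift agree_def by (auto simp: PiE_iff split: if_splits)
  moreover have "{i. ?C i \<noteq> S} \<subseteq> {- N..N}"
    by (auto split: if_splits)
  then have "finite {i. ?C i \<noteq> S}"
    by (rule finite_subset) simp
  then have "openin (full_shift S) (Pi\<^sub>E UNIV ?C)"
    unfolding full_shift_def openin_PiE_gen by auto
  ultimately show ?thesis
    by simp
qed

lemma openin_full_shift_contains_agree:
  assumes "openin (full_shift S) U" "x \<in> U"
  obtains N where "\<And>y. y \<in> topspace (full_shift S) \<Longrightarrow> agree N x y \<Longrightarrow> y \<in> U"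
proof -
  obtain C where C: "x \<in> Pi\<^sub>E UNIV C" "\<And>i. C i \<subseteq> S" "finite {i. C i \<noteq> S}" "Pi\<^sub>E UNIV C \<subseteq> U"
    using product_topology_open_contains_basis[OF assms(1)[unfolded full_shift_def] assms(2)] by auto
  \<comment> \<open>The inserted \<open>0\<close> keeps the maximum defined when no coordinate is
    constrained.\<close>
  define N where "N = Max (insert 0 (abs ` {i. C i \<noteq> S}))"
  have bound: "\<bar>i\<bar> \<le> N" if "C i \<noteq> S" for i
    unfolding N_def using C(3) that by (intro Max_ge) auto
  have "y \<in> U" if "y \<in> topspace (full_shift S)" "agree N x y" for y
  proof -
    have "y i \<in> C i" for i
    proof (cases "C i = S")
      case True
      then show ?thesis
        using that(1) by (auto simp: topspace_full_shift)
    next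
      case False
      then have "y i = x i"
        using agreeD[OF that(2) bound] by simp
      then show ?thesis
        using C(1) by (auto simp: PiE_iff)
    qed
    then show ?thesis
      using C(4) by auto
  qed
  then show ?thesis
    using that by blast
qed

lemma compact_space_full_shift: "finite S \<Longrightarrow> compact_space (full_shift S)"
  unfolding full_shift_def compact_space_product_topology
  by (simp add: compact_space_discrete_topology)

lemma group_rat_add_group: "group rat_add_group"
  using comm_group_rat_add_group by (rule comm_group.axioms(2))

lemma inv_rat_add_group: "inv\<^bsub>rat_add_group\<^esub> x = - x"
  by (rule group.inv_equality[OF group_rat_add_group]) (simp_all add: rat_add_group_def)

text \<open>\<open>m\<close> is invertible modulo \<open>q\<close>. Typical use: adding a multiple
  of a power of \<open>p\<close> moves a shift exponent into a prescribed residue class modulo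
  \<open>q\<close>.\<close>

lemma exists_mult_cong:
  fixes m q t e :: int
  assumes "coprime m q"
  shows "\<exists>s. q dvd t + m * s - e"
proof -
  obtain u v where uv: "u * m + v * q = 1"
    using bezout_int[of m q] assms by (auto simp: coprime_iff_gcd_eq_1)
  have "t + m * (u * (e - t)) - e = (e - t) * (u * m - 1)"
    by (simp add: algebra_simps)
  also have "\<dots> = q * (v * (t - e))"
    using uv by (simp add: algebra_simps flip: uv)
  finally show ?thesis
    by (metis dvd_triv_left)
qed

section \<open>Arithmetic of the hole pattern\<close>

locale toeplitz_pattern =
  fixes p q :: int
  assumes q_pos: "0 < q" and two_q_less: "2 * q < p" and coprime: "coprime p q"
begin

lemma p_pos: "0 < p"
  using q_pos two_q_less by linarith

definition hole :: "int \<Rightarrow> bool" where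
  "hole i \<longleftrightarrow> odd (i mod p) \<and> i mod p < 2 * q"

text \<open>For a hole, its rank among all holes counted from the block at \<open>0\<close>: there
  are \<open>q\<close> holes per block, and \<open>j\<close> of them precede the residue
  \<open>2 * j + 1\<close>.\<close>

definition ind :: "int \<Rightarrow> int" where
  "ind i = q * (i div p) + (i mod p) div 2"

definition pos :: "int \<Rightarrow> int" where
  "pos j = p * (j div q) + (2 * (j mod q) + 1)"

definition fill :: "(int \<Rightarrow> nat) \<Rightarrow> (int \<Rightarrow> nat)" where
  "fill y = (\<lambda>i. if hole i then y (ind i) else nat (i mod p))"

definition unfill :: "(int \<Rightarrow> nat) \<Rightarrow> (int \<Rightarrow> nat)" where
  "unfill z = (\<lambda>j. z (pos j))"

lemma pos_mod: "pos j mod p = 2 * (j mod q) + 1" and pos_div: "pos j div p = j div q"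
proof -
  have "0 \<le> j mod q" "j mod q < q"
    using q_pos by auto
  then have *: "0 \<le> 2 * (j mod q) + 1" "2 * (j mod q) + 1 < p"
    using two_q_less by linarith+
  show "pos j mod p = 2 * (j mod q) + 1"
    unfolding pos_def mod_mult_self4 using * by (simp add: mod_pos_pos_trivial)
  have "pos j div p = j div q + (2 * (j mod q) + 1) div p"
    unfolding pos_def using p_pos div_mult_self4[of p "2 * (j mod q) + 1" "j div q"] by simp
  then show "pos j div p = j div q"
    using * by (simp add: div_pos_pos_trivial)
qed

lemma hole_pos: "hole (pos j)"
  using pos_mod_bound[OF q_pos, of j] by (simp add: hole_def pos_mod)

lemma ind_pos: "ind (pos j) = j"
  unfolding ind_def by (simp add: pos_mod pos_div)

lemma pos_ind:
  assumes "hole i"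
  shows "pos (ind i) = i"
proof -
  let ?j = "(i mod p) div 2"
  have *: "0 \<le> ?j" "?j < q" "i mod p = 2 * ?j + 1"
    using assms pos_mod_sign[OF p_pos, of i] unfolding hole_def by (auto elim: oddE)
  have "ind i mod q = ?j"
    unfolding ind_def mod_mult_self4 using * by (simp add: mod_pos_pos_trivial)
  moreover have "ind i div q = i div p"
    unfolding ind_def using * q_pos by (simp add: div_mult_self4 div_pos_pos_trivial)
  ultimately have "pos (ind i) = p * (i div p) + (2 * ?j + 1)"
    by (simp add: pos_def)
  then show ?thesis
    using *(3) by simp
qed

lemma hole_add_mult [simp]: "hole (i + p * m) = hole i"
  by (simp add: hole_def)

lemma ind_add_mult: "ind (i + p * m) = ind i + q * m"
  using p_pos by (simp add: ind_def algebra_simps)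

text \<open>A block contributes \<open>p\<close> to a position but only \<open>q\<close> to a rank,
  so ranks lie nearer the origin. On the negative side the gain of at least \<open>p - q\<close>
  beats the offset \<open>?j + 1 \<le> q\<close> because \<open>2 * q < p\<close>.\<close>

lemma hole_less:
  assumes "hole i"
  shows "0 \<le> i \<Longrightarrow> 0 \<le> ind i \<and> ind i < i" and "i < 0 \<Longrightarrow> ind i < 0 \<and> i < ind i"
proof -
  let ?j = "ind i mod q" and ?n = "ind i div q"
  have i: "i = p * ?n + (2 * ?j + 1)"
    using pos_ind[OF assms] by (simp add: pos_def)
  have j: "0 \<le> ?j" "?j < q" 
    using q_pos by auto
  have e: "ind i = q * ?n + ?j"
    by simp
  show "0 \<le> ind i \<and> ind i < i" if "0 \<le> i"
  proof -
    have "0 \<le> ?n"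
      using that i j two_q_less mult_left_mono[of ?n "-1" p] by linarith
    then have "0 \<le> q * ?n" "q * ?n \<le> p * ?n"
      using q_pos two_q_less by (auto intro: mult_right_mono)
    then show ?thesis
      using i e j by linarith
  qed
  show "ind i < 0 \<and> i < ind i" if "i < 0"
  proof -
    have n: "?n \<le> - 1"
    proof (rule ccontr)
      assume "\<not> ?n \<le> - 1"
      then have "0 \<le> p * ?n"
        using p_pos by simp
      then show False
        using i j that by linarith
    qed
    then have "q * ?n \<le> - q" "(p - q) * ?n \<le> - (p - q)"
      using q_pos two_q_less mult_left_mono[of ?n "-1" q] mult_left_mono[of ?n "-1" "p - q"]
      by auto
    then have "q * ?n \<le> - q" "p * ?n - q * ?n \<le> q - p"
      by (simp_all add: left_diff_distrib)
    then show ?thesis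
      using i e j two_q_less by linarith
  qed
qed

lemma abs_ind_less: "hole i \<Longrightarrow> \<bar>ind i\<bar> < \<bar>i\<bar>"
  using hole_less[of i] by linarith

lemma abs_pos_le: "\<bar>pos j\<bar> \<le> p * \<bar>j\<bar> + p"
proof -
  have "\<bar>j div q\<bar> \<le> \<bar>j\<bar>"
    using q_pos zdiv_mono2[of j 1 q] zdiv_mono2_neg[of j 1 q]
      pos_imp_zdiv_nonneg_iff[OF q_pos, of j] pos_imp_zdiv_neg_iff[OF q_pos, of j]
    by (cases "0 \<le> j") auto
  then have "\<bar>p * (j div q)\<bar> \<le> p * \<bar>j\<bar>"
    using p_pos by (simp add: abs_mult)
  moreover have "0 \<le> 2 * (j mod q) + 1" "2 * (j mod q) + 1 \<le> p"
    using q_pos two_q_less pos_mod_bound[OF q_pos, of j] pos_mod_sign[OF q_pos, of j] by linarith+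
  ultimately show ?thesis
    unfolding pos_def by linarith
qed

text \<open>Neighbouring holes of a block are two apart, and a block of length
  \<open>p > 2 * q\<close> has only \<open>q\<close> of them. This factor two halves the windows in
  \<open>endos_descend\<close>.\<close>

lemma ind_gap:
  assumes "hole i" "hole k" "i \<le> k"
  shows "ind i \<le> ind k" and "2 * (ind k - ind i) \<le> k - i"
proof -
  define n m a b where "n = ind i div q" "m = ind k div q" "a = ind i mod q" "b = ind k mod q"
  have i: "i = p * n + (2 * a + 1)" and k: "k = p * m + (2 * b + 1)"
    using pos_ind[OF assms(1)] pos_ind[OF assms(2)] by (simp_all add: pos_def n_m_a_b_def)
  have e: "ind i = q * n + a" "ind k = q * m + b"
    by (simp_all add: n_m_a_b_def)
  have ab: "0 \<le> a" "a < q" "0 \<le> b" "b < q"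
    using q_pos by (simp_all add: n_m_a_b_def)
  have nm: "n \<le> m"
  proof (rule ccontr)
    assume "\<not> n \<le> m"
    then have "p * 1 \<le> p * (n - m)"
      using p_pos by (intro mult_left_mono) auto
    then show False
      using assms(3) ab two_q_less unfolding i k by (simp add: algebra_simps)
  qed
  then have "2 * q * (m - n) \<le> p * (m - n)"
    using two_q_less by (intro mult_right_mono) auto
  then show "2 * (ind k - ind i) \<le> k - i"
    using i k e by (simp add: algebra_simps)
  show "ind i \<le> ind k"
  proof (cases "n = m")
    case True
    then show ?thesis
      using assms(3) e i k by simp
  next
    case False
    then have "q * 1 \<le> q * (m - n)"
      using nm q_pos by (intro mult_left_mono) auto
    then show ?thesis
      using ab e by (simp add: algebra_simps)
  qed
qed

lemma fill_shift_pow: "fill (shift_pow (q * m) y) = shift_pow (p * m) (fill y)"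
  by (auto simp: fill_def fun_eq_iff ind_add_mult)

lemma unfill_fill [simp]: "unfill (fill y) = y"
  by (simp add: fill_def unfill_def hole_pos ind_pos)

text \<open>A hole reads its content nearer the origin, so filling needs no larger window.\<close>

lemma agree_fill: "agree N x y \<Longrightarrow> agree N (fill x) (fill y)"
  using abs_ind_less unfolding agree_def fill_def by fastforce

lemma agree_unfill: "agree (p * N + p) x y \<Longrightarrow> agree N (unfill x) (unfill y)"
proof -
  assume *: "agree (p * N + p) x y"
  have "\<bar>pos j\<bar> \<le> p * N + p" if "\<bar>j\<bar> \<le> N" for j
    using abs_pos_le[of j] mult_left_mono[OF that, of p] p_pos by linarith
  then show ?thesis
    using * by (simp add: agree_def unfill_def)
qed

section \<open>The Toeplitz point and its orbit closure\<close>

function base :: "int \<Rightarrow> nat" where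
  "base i = (if hole i then base (ind i) else nat (i mod p))"
  by auto
termination
  by (relation "Wellfounded.measure (\<lambda>i. nat \<bar>i\<bar>)") (use abs_ind_less in fastforce)+

declare base.simps [simp del]

lemma fill_base: "fill base = base"
proof
  show "fill base i = base i" for i
    using base.simps[of i] by (simp add: fill_def)
qed

lemma shift_pow_mult_base: "shift_pow (p * m) base = fill (shift_pow (q * m) base)"
  by (simp add: fill_shift_pow fill_base)

text \<open>Moving a hole by a multiple of \<open>p ^ Suc k\<close> moves its rank by a multiple of
  \<open>q * p ^ k\<close>, so each level of nested holes costs one factor \<open>p\<close> in the
  period.\<close>

lemma base_periodic: "\<exists>k. \<forall>m. base (i + p ^ k * m) = base i"
proof (induction i rule: base.induct)
  case (1 i)
  show ?case
  proof (cases "hole i")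
    case True
    then obtain k where k: "base (ind i + p ^ k * m) = base (ind i)" for m
      using 1 by blast
    have "base (i + p ^ Suc k * m) = base i" for m
    proof -
      have "base (i + p * (p ^ k * m)) = base (ind (i + p * (p ^ k * m)))"
        using True base.simps[of "i + p * (p ^ k * m)"] by simp
      also have "ind (i + p * (p ^ k * m)) = ind i + p ^ k * (q * m)"
        by (simp add: ind_add_mult mult.left_commute)
      also have "base \<dots> = base i"
        using True base.simps[of i] by (simp add: k)
      finally show ?thesis
        by (simp add: mult.assoc)
    qed
    then show ?thesis
      by blast
  next
    case False
    then have "base (i + p ^ 1 * m) = base i" for m
      using base.simps[of i] base.simps[of "i + p * m"] by simp
    then show ?thesis
      by blast
  qed
qed

lemma base_periodic_window:
  assumes "finite W"
  shows "\<exists>k. \<forall>l\<ge>k. \<forall>i\<in>W. \<forall>m. base (i + p ^ l * m) = base i"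
proof -
  obtain \<kappa> where \<kappa>: "base (i + p ^ \<kappa> i * m) = base i" for i m
    using base_periodic by metis
  have "base (i + p ^ l * m) = base i" if "i \<in> W" "l \<ge> Max (insert 0 (\<kappa> ` W))" for i l m
  proof -
    have "\<kappa> i \<le> l"
      using that assms by (meson Max_ge finite.insertI finite_imageI image_eqI insertI2 order_trans)
    then have "p ^ l = p ^ \<kappa> i * p ^ (l - \<kappa> i)"
      by (simp flip: power_add)
    then show ?thesis
      using \<kappa>[of i "p ^ (l - \<kappa> i) * m"] by (simp add: mult.assoc)
  qed
  then show ?thesis
    by blast
qed

text \<open>The orbit map is continuous for the \<open>p\<close>-adic topology on exponents:
  multiples of high powers of \<open>p\<close> act almost trivially on \<open>base\<close>.\<close>

lemma agree_shift_pow_base: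
  "\<exists>k. \<forall>l\<ge>k. \<forall>m. agree N (shift_pow (t + p ^ l * m) base) (shift_pow t base)"
proof -
  obtain k where k: "base (i + p ^ l * m) = base i" if "l \<ge> k" "i \<in> {t - N..t + N}" for l i m
    using base_periodic_window[of "{t - N..t + N}"] by blast
  have "agree N (shift_pow (t + p ^ l * m) base) (shift_pow t base)" if "l \<ge> k" for l m
    unfolding agree_def
  proof (intro allI impI)
    fix i :: int
    assume "\<bar>i\<bar> \<le> N"
    then have "i + t \<in> {t - N..t + N}"
      by auto
    then show "shift_pow (t + p ^ l * m) base i = shift_pow t base i"
      using k[OF that, of "i + t" m] by (simp add: add.assoc)
  qed
  then show ?thesis
    by blast
qed

text \<open>The orbit closure in terms of cylinders; \<open>X_closure\<close> identifies it with the
  topological one.\<close>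

definition X :: "(int \<Rightarrow> nat) set" where
  "X = {y. \<forall>N. \<exists>t. agree N y (shift_pow t base)}"

text \<open>Correcting the exponent by multiples of \<open>p ^ k\<close> reaches a multiple of
  \<open>q\<close>; such shifts of \<open>base\<close> are the ones whose fillings are again shifts
  of \<open>base\<close>.\<close>

lemma X_approx:
  assumes "y \<in> X"
  shows "\<exists>m. agree N y (shift_pow (q * m) base)"
proof -
  obtain t where t: "agree N y (shift_pow t base)"
    using assms by (auto simp: X_def)
  obtain k where k: "agree N (shift_pow (t + p ^ k * m) base) (shift_pow t base)" for m
    using agree_shift_pow_base by blast
  obtain s where "q dvd t + p ^ k * s - 0"
    using exists_mult_cong[of "p ^ k" q t 0] coprime by auto
  then obtain m where "t + p ^ k * s = q * m"
    by (auto elim: dvdE)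
  then show ?thesis
    using t k[of s] by (metis agree_sym agree_trans)
qed

lemma shift_pow_in_X:
  assumes "y \<in> X"
  shows "shift_pow k y \<in> X"
  unfolding X_def
proof safe
  fix N
  obtain t where "agree (N + \<bar>k\<bar>) y (shift_pow t base)"
    using assms by (auto simp: X_def)
  then show "\<exists>t. agree N (shift_pow k y) (shift_pow t base)"
    using agree_shift_pow[of N k] by (metis shift_pow_add)
qed

lemma base_in_X: "base \<in> X"
  unfolding X_def using shift_pow_0[of base] by (auto simp: agree_def intro!: exI[of _ 0])

lemma fill_in_X:
  assumes "y \<in> X"
  shows "fill y \<in> X"
  unfolding X_def
proof safe
  fix N
  obtain m where "agree N y (shift_pow (q * m) base)"
    using X_approx[OF assms] by blast
  then show "\<exists>t. agree N (fill y) (shift_pow t base)"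
    using agree_fill shift_pow_mult_base by metis
qed

section \<open>Phases and the self-similar decomposition of the orbit closure\<close>

text \<open>The phase \<open>c\<close> records where the blocks of \<open>z\<close> begin.
  Restricting to a window lets it be inherited from approximating shifts of
  \<open>base\<close>.\<close>

definition phased :: "int \<Rightarrow> int \<Rightarrow> (int \<Rightarrow> nat) \<Rightarrow> bool" where
  "phased M c z \<longleftrightarrow> (\<forall>i. \<bar>i\<bar> \<le> M \<longrightarrow> \<not> hole (i + c) \<longrightarrow> z i = nat ((i + c) mod p))"

lemma phased_fill: "phased M c (shift_pow c (fill y))"
  by (simp add: phased_def fill_def)

lemma phased_base: "phased M c (shift_pow c base)"
  using phased_fill[of M c base] by (simp add: fill_base)

lemma phased_agree: "phased M c x \<Longrightarrow> agree M x y \<Longrightarrow> phased M c y"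
  by (simp add: phased_def agree_def)

lemma phased_mono: "phased M c x \<Longrightarrow> N \<le> M \<Longrightarrow> phased N c x"
  by (simp add: phased_def)

lemma phased_cong:
  assumes "phased M c x" "p dvd d - c"
  shows "phased M d x"
proof -
  obtain m where "d = c + p * m"
    using assms(2) by (metis diff_eq_eq add.commute dvdE)
  then show ?thesis
    using assms(1) by (simp add: phased_def add.assoc[symmetric])
qed

text \<open>Two phases differing by \<open>e\<close> would force a position to carry both the symbols \<open>0\<close> and \<open>e\<close> or,
  if \<open>e\<close> is a hole, both \<open>p - 1\<close> and \<open>e - 1\<close>.\<close>

lemma phased_unique:
  assumes "phased p c z" "phased p d z"
  shows "p dvd d - c"
proof -
  define e where "e = (d - c) mod p"
  have e: "0 \<le> e" "e < p"
    using p_pos by (simp_all add: e_def)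
  have shift: "(i + d) mod p = ((i + c) mod p + e) mod p" for i
    using mod_add_eq[of "i + c" p "d - c"] by (simp add: e_def)
  have "e = 0"
  proof (cases "hole e")
    case False
    define i where "i = (- c) mod p"
    have i: "0 \<le> i" "i < p"
      using p_pos by (simp_all add: i_def)
    have c0: "(i + c) mod p = 0"
      by (simp add: i_def mod_simps)
    have d0: "(i + d) mod p = e"
      using shift[of i] c0 e by simp
    have "z i = nat 0"
      using assms(1) i c0 unfolding phased_def hole_def by auto
    moreover have "z i = nat e"
      using assms(2) i d0 False e unfolding phased_def hole_def by auto
    ultimately show ?thesis
      using e by simp
  next
    case True
    then have odd: "odd e" "e < 2 * q"
      using e by (simp_all add: hole_def)
    then have e1: "1 \<le> e"
      using e by (cases "e = 0") auto
    define i where "i = (- c - 1) mod p"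
    have i: "0 \<le> i" "i < p"
      using p_pos by (simp_all add: i_def)
    have "(i + c) mod p = (- 1) mod p"
      by (simp add: i_def mod_simps)
    then have c0: "(i + c) mod p = p - 1"
      using p_pos by (simp add: zmod_minus1)
    have "(i + d) mod p = (e - 1 + p) mod p"
      using shift[of i] unfolding c0 by (simp add: algebra_simps)
    also have "\<dots> = e - 1"
      using e e1 by (simp only: mod_add_self2) (simp add: mod_pos_pos_trivial)
    finally have d0: "(i + d) mod p = e - 1" .
    have "z i = nat (p - 1)"
      using assms(1) i c0 two_q_less unfolding phased_def hole_def by auto
    moreover have "z i = nat (e - 1)"
      using assms(2) i d0 odd unfolding phased_def hole_def by auto
    ultimately show ?thesis
      using odd two_q_less e1 by linarith
  qed
  then show ?thesis
    by (simp add: e_def dvd_eq_mod_eq_0)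
qed

text \<open>Approximation gives a phase on each window. Uniqueness on the radius \<open>p\<close>
  makes them all congruent modulo \<open>p\<close>, so one phase serves every window.\<close>

lemma X_phased:
  assumes "x \<in> X"
  shows "\<exists>c\<in>{0..<p}. \<forall>M. phased M c x"
proof -
  have *: "\<exists>c. phased M c x" for M
    using assms phased_base phased_agree agree_sym unfolding X_def by blast
  obtain c where c: "phased p c x"
    using * by blast
  have "phased M c x" for M
  proof -
    obtain d where d: "phased (max M p) d x"
      using * by blast
    then have "p dvd c - d"
      using c phased_mono phased_unique by (metis max.cobounded2)
    then show ?thesis
      using d phased_cong phased_mono by (metis max.cobounded1)
  qed
  then have "phased M (c mod p) x" for M
    by (rule phased_cong) (simp add: mod_eq_dvd_iff[symmetric] mod_simps)
  then show ?thesis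
    using p_pos by (meson atLeastLessThan_iff pos_mod_bound pos_mod_sign)
qed

lemma phased_shift_pow:
  assumes "\<And>M. phased M c x"
  shows "phased M (c + d) (shift_pow d x)"
  unfolding phased_def
proof (intro allI impI)
  fix i :: int
  assume "\<not> hole (i + (c + d))"
  then show "shift_pow d x i = nat ((i + (c + d)) mod p)"
    using assms[of "\<bar>i + d\<bar>"] by (simp add: phased_def algebra_simps)
qed

lemma fill_unfill: "(\<And>M. phased M 0 z) \<Longrightarrow> fill (unfill z) = z"
  by (fastforce simp: fill_def unfill_def phased_def pos_ind)

text \<open>Phase \<open>0\<close> forces a good approximating exponent to be a multiple of
  \<open>p\<close>, and then the approximant is filled from a shift of \<open>base\<close>.\<close>

lemma unfill_in_X:
  assumes "z \<in> X" "\<And>M. phased M 0 z"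
  shows "unfill z \<in> X"
  unfolding X_def
proof safe
  fix N
  \<comment> \<open>Radius \<open>p\<close> pins down the phase; radius \<open>p * N + p\<close>
    suffices to read the hole contents up to \<open>N\<close>.\<close>
  obtain t where t: "agree (max p (p * N + p)) z (shift_pow t base)"
    using assms by (auto simp: X_def)
  have "phased p t z"
    using t phased_base phased_agree agree_sym agree_mono by (metis max.cobounded1)
  then have "p dvd t - 0"
    using assms(2) phased_unique by blast
  then obtain m where "t = p * m"
    by auto
  then have "agree (p * N + p) z (fill (shift_pow (q * m) base))"
    using t shift_pow_mult_base by (metis agree_mono max.cobounded2)
  then show "\<exists>t. agree N (unfill z) (shift_pow t base)"
    using agree_unfill by fastforce
qed

lemma X_decomp:
  assumes "x \<in> X"
  obtains c y where "0 \<le> c" "c < p" "y \<in> X" "x = shift_pow c (fill y)"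
proof -
  obtain c where c: "c \<in> {0..<p}" "\<And>M. phased M c x"
    using X_phased[OF assms] by blast
  define z where "z = shift_pow (- c) x"
  have "phased M 0 z" for M
    using phased_shift_pow[OF c(2), of M "- c"] by (simp add: z_def)
  moreover have "z \<in> X"
    by (simp add: assms shift_pow_in_X z_def)
  moreover have "x = shift_pow c z"
    unfolding z_def by (simp flip: shift_pow_add) (simp add: shift_pow_0)
  ultimately show ?thesis
    using that[of c "unfill z"] c(1) fill_unfill unfill_in_X by auto
qed

text \<open>Phases are unique modulo \<open>p\<close>, so a decomposition as in
  \<open>X_decomp\<close> is unique up to trading \<open>m\<close> whole blocks for
  \<open>q * m\<close> symbols of content.\<close>

lemma shift_pow_fill_inject:
  assumes "y \<in> X" "shift_pow c (fill x) = shift_pow d (fill y)"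
  obtains m where "d = c + p * m" "x = shift_pow (q * m) y"
proof -
  have "p dvd d - c"
    using assms(2) phased_fill phased_unique by metis
  then obtain m where m: "d = c + p * m"
    by (metis diff_eq_eq add.commute dvdE)
  have "fill x = shift_pow (- c) (shift_pow c (fill x))"
    by (simp flip: shift_pow_add) (simp add: shift_pow_0)
  also have "\<dots> = shift_pow (p * m) (fill y)"
    unfolding assms(2) m by (simp flip: shift_pow_add)
  also have "\<dots> = fill (shift_pow (q * m) y)"
    by (simp add: fill_shift_pow)
  finally show ?thesis
    using that[OF m] by (metis unfill_fill)
qed

text \<open>The exponent of an approximating shift matters only modulo the common period
  \<open>p ^ k\<close> of \<open>base\<close> on \<open>W\<close>, which leaves finitely many
  candidates for \<open>c\<close>.\<close>

lemma X_periodic: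
  assumes "v \<in> X" "finite W"
  shows "\<exists>k c. \<forall>n\<in>W. \<forall>m. v (n - c + p ^ k * m) = base n"
proof -
  obtain k where k: "base (n + p ^ k * m) = base n" if "n \<in> W" for n m
    using base_periodic_window[OF assms(2)] by blast
  have "\<exists>c\<in>{0..<p ^ k}. \<forall>n\<in>W. \<forall>m. v (n - c + p ^ k * m) = base n"
  proof (rule ccontr)
    assume "\<not> ?thesis"
    then obtain \<nu> \<mu> where bad: "\<nu> c \<in> W" "v (\<nu> c - c + p ^ k * \<mu> c) \<noteq> base (\<nu> c)"
      if "c \<in> {0..<p ^ k}" for c
      by metis
    \<comment> \<open>One window containing a failure for every residue; the exponent approximating
      \<open>v\<close> on it has a residue that does not fail.\<close>
    define M where "M = Max (insert 0 ((\<lambda>c. \<bar>\<nu> c - c + p ^ k * \<mu> c\<bar>) ` {0..<p ^ k}))"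
    obtain t where t: "agree M v (shift_pow t base)"
      using assms by (auto simp: X_def)
    define c where "c = t mod p ^ k"
    have c: "c \<in> {0..<p ^ k}"
      using p_pos by (simp add: c_def)
    have "\<bar>\<nu> c - c + p ^ k * \<mu> c\<bar> \<le> M"
      unfolding M_def using c by (intro Max_ge) auto
    then have "v (\<nu> c - c + p ^ k * \<mu> c) = base (\<nu> c + (t - c) + p ^ k * \<mu> c)"
      using agreeD[OF t] by (simp add: algebra_simps)
    also have "t - c = p ^ k * (t div p ^ k)"
      by (simp add: c_def minus_mod_eq_mult_div)
    finally have "v (\<nu> c - c + p ^ k * \<mu> c) = base (\<nu> c + p ^ k * (t div p ^ k + \<mu> c))"
      by (simp add: algebra_simps)
    then show False
      using bad[OF c] k by simp
  qed
  then show ?thesis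
    by blast
qed

section \<open>From commuting with \<open>shift_pow q\<close> to commuting with the shift\<close>

lemma shift_pow_iterate:
  assumes g: "\<And>x. x \<in> X \<Longrightarrow> g (shift_pow k x) = shift_pow k (g x)" and "x \<in> X"
  shows "g (shift_pow (k * m) x) = shift_pow (k * m) (g x)"
proof (induction m rule: int_induct[where k = 0])
  case base
  then show ?case
    by (simp add: shift_pow_0)
next
  case (step1 i)
  have "shift_pow (k * (i + 1)) y = shift_pow k (shift_pow (k * i) y)" for y
    by (simp add: algebra_simps flip: shift_pow_add)
  then show ?case
    using step1 g assms(2) by (simp only: shift_pow_in_X)
next
  case (step2 i)
  have *: "shift_pow (k * i) y = shift_pow k (shift_pow (k * (i - 1)) y)" for y
    by (simp add: algebra_simps flip: shift_pow_add)
  have "shift_pow k (g (shift_pow (k * (i - 1)) x)) = shift_pow k (shift_pow (k * (i - 1)) (g x))"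
    using step2(2) g[OF shift_pow_in_X, OF assms(2)] by (simp only: *)
  then show ?case
    by (simp only: shift_pow_eq_iff)
qed

text \<open>Along a progression of step prime to \<open>p\<close>, every point of \<open>X\<close> meets one of its periodic
  positions; there \<open>u = g (\<sigma> x)\<close> and \<open>v = \<sigma> (g x)\<close> must agree, because \<open>\<sigma>\<close> is a limit of powers of
  \<open>\<sigma>\<^sup>q\<close> on the orbit of the Toeplitz point.\<close>

lemma commute_shift_base:
  assumes X: "\<And>x. x \<in> X \<Longrightarrow> g x \<in> X"
    and cont: "\<And>x M. x \<in> X \<Longrightarrow> \<exists>N. \<forall>y\<in>X. agree N x y \<longrightarrow> agree M (g x) (g y)"
    and comm: "\<And>x. x \<in> X \<Longrightarrow> g (shift_pow q x) = shift_pow q (g x)"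
    and x: "x = shift_pow t base"
  shows "g (shift_pow 1 x) = shift_pow 1 (g x)"
proof
  fix i
  define u v where "u = g (shift_pow 1 x)" and "v = shift_pow 1 (g x)"
  note iter = shift_pow_iterate[of g q, OF comm]
  have xX: "shift_pow k x \<in> X" "x \<in> X" for k
    unfolding x using base_in_X shift_pow_in_X by blast+
  have vX: "v \<in> X"
    using X xX shift_pow_in_X by (simp add: v_def)
  \<comment> \<open>For \<open>q dvd m\<close> the shift by \<open>p ^ l * m\<close> is a power of
    \<open>shift_pow q\<close> and passes through \<open>g\<close>; for large \<open>l\<close> it
    hardly moves the argument, so the coordinate \<open>j\<close> of the image is unchanged.\<close>
  have period: "\<exists>K. \<forall>l\<ge>K. \<forall>m. q dvd m \<longrightarrow> (g (shift_pow r x)) (j + p ^ l * m) = (g (shift_pow r x)) j"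
    for r j
  proof -
    obtain N where N: "agree \<bar>j\<bar> (g (shift_pow r x)) (g y)"
      if "y \<in> X" "agree N (shift_pow r x) y" for y
      using cont[OF xX(1)] by blast
    obtain K where K: "agree N (shift_pow (r + t + p ^ l * m) base) (shift_pow (r + t) base)"
      if "l \<ge> K" for l m
      using agree_shift_pow_base by blast
    have "(g (shift_pow r x)) (j + p ^ l * m) = (g (shift_pow r x)) j" if l: "l \<ge> K" and "q dvd m" for l m
    proof -
      obtain m' where m: "p ^ l * m = q * m'"
        using \<open>q dvd m\<close> by (metis dvdE dvd_mult)
      have eq: "shift_pow (q * m') (shift_pow r x) = shift_pow (r + t + p ^ l * m) base"
        unfolding x m by (simp add: algebra_simps flip: shift_pow_add)
      have "agree \<bar>j\<bar> (g (shift_pow r x)) (g (shift_pow (q * m') (shift_pow r x)))"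
        using K[OF l, of m, folded eq] xX
        by (intro N shift_pow_in_X) (simp_all add: x agree_sym flip: shift_pow_add)
      then have "agree \<bar>j\<bar> (g (shift_pow r x)) (shift_pow (q * m') (g (shift_pow r x)))"
        using iter xX by simp
      then show ?thesis
        using agreeD[of "\<bar>j\<bar>" "g (shift_pow r x)" _ j] by (simp add: m)
    qed
    then show ?thesis
      by blast
  qed
  obtain K1 where K1: "u (i + p ^ l * m) = u i" if "l \<ge> K1" "q dvd m" for l m
    using period[of 1 i] unfolding u_def by blast
  obtain K2 where K2: "v (i + p ^ l * m) = v i" if "l \<ge> K2" "q dvd m" for l m
    using period[of 0 "i + 1"] unfolding v_def
    by (auto simp: shift_pow_0 algebra_simps)
  define K where "K = max K1 K2"
  \<comment> \<open>A complete residue system contains some \<open>n\<close> congruent to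
    \<open>i + c\<close> modulo \<open>p ^ K\<close>. Choosing \<open>s\<close> makes
    \<open>j\<close> congruent to \<open>i\<close> modulo \<open>q\<close> as well, so
    \<open>u\<close> and \<open>v\<close> take the same values at \<open>j\<close> as at
    \<open>i\<close>, and \<open>v\<close> has period \<open>p ^ k\<close> at
    \<open>j\<close>.\<close>
  obtain k c where kc: "v (n - c + p ^ k * m) = base n" if "n \<in> {0..<p ^ K}" for n m
    using X_periodic[OF vX, of "{0..<p ^ K}"] by blast
  define n where "n = (i + c) mod p ^ K"
  have n: "n \<in> {0..<p ^ K}"
    using p_pos by (simp add: n_def)
  obtain s where s: "q dvd n - c + p ^ (k + K) * s - i"
    using exists_mult_cong[of "p ^ (k + K)" q] coprime by auto
  define j where "j = n - c + p ^ (k + K) * s"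
  have "j - i = p ^ K * (p ^ k * s - (i + c) div p ^ K)"
  proof -
    have "n = i + c - p ^ K * ((i + c) div p ^ K)"
      by (simp add: n_def minus_mult_div_eq_mod)
    then show ?thesis
      by (simp add: j_def algebra_simps power_add)
  qed
  moreover have "q dvd j - i"
    using s by (simp add: j_def)
  ultimately obtain m where m: "j = i + p ^ K * m" "q dvd m"
    using coprime by (metis add.commute coprime_commute coprime_dvd_mult_right_iff coprime_power_right_iff diff_eq_eq)
  have uj: "u j = u i" and vj: "v j = v i"
    using K1[of K m] K2[of K m] m by (simp_all add: K_def)
  have vper: "v (j + p ^ l * r) = v j" if "l \<ge> k" for l r
  proof -
    have "p ^ l = p ^ k * p ^ (l - k)"
      using that by (simp flip: power_add)
    then have "j + p ^ l * r = n - c + p ^ k * (p ^ K * s + p ^ (l - k) * r)"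
      "j = n - c + p ^ k * (p ^ K * s)"
      by (simp_all add: j_def power_add algebra_simps)
    then show ?thesis
      using kc[OF n] by metis
  qed
  obtain N where N: "agree \<bar>j\<bar> u (g y)" if "y \<in> X" "agree N (shift_pow 1 x) y" for y
    using cont[OF xX(1)] unfolding u_def by blast
  obtain L where L: "agree N (shift_pow (1 + t + p ^ l * r) base) (shift_pow (1 + t) base)"
    if "l \<ge> L" for l r
    using agree_shift_pow_base by blast
  define l where "l = max k L"
  \<comment> \<open>\<open>1 + p ^ l * s'\<close> is \<open>p\<close>-adically near \<open>1\<close>
    and divisible by \<open>q\<close>, so this power of \<open>shift_pow q\<close> imitates the
    shift on \<open>x\<close>; the surplus \<open>p ^ l * s'\<close> is absorbed by the periodicity
    of \<open>v\<close> at \<open>j\<close>.\<close>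
  obtain s' where "q dvd 1 + p ^ l * s' - 0"
    using exists_mult_cong[of "p ^ l" q 1 0] coprime by auto
  then obtain r where r: "1 + p ^ l * s' = q * r"
    by auto
  have eq: "shift_pow (q * r) x = shift_pow (1 + t + p ^ l * s') base"
    unfolding x r[symmetric] by (simp add: algebra_simps flip: shift_pow_add)
  have "agree \<bar>j\<bar> u (g (shift_pow (q * r) x))"
    using L[of l s', folded eq] xX
    by (intro N shift_pow_in_X) (simp_all add: l_def x agree_sym flip: shift_pow_add)
  then have "u j = g (shift_pow (q * r) x) j"
    by (auto dest: agreeD)
  also have "\<dots> = v (j + p ^ l * s')"
    using iter[OF _ xX(2), of r] by (simp add: v_def r[symmetric] algebra_simps)
  also have "\<dots> = v j"
    using vper by (simp add: l_def)
  finally show "u i = v i"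
    using uj vj by simp
qed

text \<open>Both sides depend continuously on \<open>x\<close> and agree on the dense orbit of
  \<open>base\<close>.\<close>

lemma commute_shift:
  assumes X: "\<And>x. x \<in> X \<Longrightarrow> g x \<in> X"
    and cont: "\<And>x M. x \<in> X \<Longrightarrow> \<exists>N. \<forall>y\<in>X. agree N x y \<longrightarrow> agree M (g x) (g y)"
    and comm: "\<And>x. x \<in> X \<Longrightarrow> g (shift_pow q x) = shift_pow q (g x)"
    and x: "x \<in> X"
  shows "g (shift_pow 1 x) = shift_pow 1 (g x)"
proof (rule agree_imp_eq)
  fix M
  obtain N1 where N1: "agree M (g (shift_pow 1 x)) (g y)"
    if "y \<in> X" "agree N1 (shift_pow 1 x) y" for y
    using cont[OF shift_pow_in_X[OF x]] by blast
  obtain N2 where N2: "agree (M + 1) (g x) (g y)" if "y \<in> X" "agree N2 x y" for y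
    using cont[OF x] by blast
  obtain t where t: "agree (max (N1 + 1) N2) x (shift_pow t base)"
    using x by (auto simp: X_def)
  let ?y = "shift_pow t base"
  have y: "shift_pow k ?y \<in> X" "?y \<in> X" for k
    using base_in_X shift_pow_in_X by blast+
  have "agree M (g (shift_pow 1 x)) (g (shift_pow 1 ?y))"
    using t by (intro N1 y agree_shift_pow agree_mono[OF t]) auto
  moreover have "g (shift_pow 1 ?y) = shift_pow 1 (g ?y)"
    by (rule commute_shift_base[OF X cont comm refl])
  moreover have "agree M (shift_pow 1 (g x)) (shift_pow 1 (g ?y))"
    using agree_shift_pow[of M 1] N2[OF y(2) agree_mono[OF t]] by simp
  ultimately show "agree M (g (shift_pow 1 x)) (shift_pow 1 (g x))"
    by (metis agree_sym agree_trans)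
qed

section \<open>Endomorphisms\<close>

text \<open>A local rule in the sense of Curtis, Hedlund and Lyndon. Coordinate \<open>0\<close> is
  enough, since commuting with the shift carries the rule to the others.\<close>

definition window :: "int \<Rightarrow> int \<Rightarrow> ((int \<Rightarrow> nat) \<Rightarrow> (int \<Rightarrow> nat)) \<Rightarrow> bool" where
  "window a b f \<longleftrightarrow> (\<forall>x\<in>X. \<forall>y\<in>X. (\<forall>i\<in>{a..b}. x i = y i) \<longrightarrow> f x 0 = f y 0)"

lemma window_mono:
  assumes "window a b f" "c \<le> a" "b \<le> d"
  shows "window c d f"
proof -
  have "{a..b} \<subseteq> {c..d}"
    using assms by simp
  then show ?thesis
    using assms(1) unfolding window_def by blast
qed

text \<open>Values outside \<open>X\<close> are left free so that plain composition can be used;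
  extensionality returns in \<open>carrier_endo_monoid\<close>.\<close>

definition endos :: "((int \<Rightarrow> nat) \<Rightarrow> (int \<Rightarrow> nat)) set" where
  "endos = {f. (\<forall>x\<in>X. f x \<in> X) \<and> (\<forall>x\<in>X. f (shift_pow 1 x) = shift_pow 1 (f x)) \<and>
     (\<exists>a b. window a b f)}"

lemma endosI:
  assumes "\<And>x. x \<in> X \<Longrightarrow> f x \<in> X" "\<And>x. x \<in> X \<Longrightarrow> f (shift_pow 1 x) = shift_pow 1 (f x)"
    and "\<And>x y. x \<in> X \<Longrightarrow> y \<in> X \<Longrightarrow> agree N x y \<Longrightarrow> f x 0 = f y 0"
  shows "f \<in> endos"
proof -
  have "window (- N) N f"
    unfolding window_def by (intro ballI impI assms(3)) (auto simp: agree_def abs_le_iff)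
  then show ?thesis
    using assms unfolding endos_def by blast
qed

lemma endos_in_X: "f \<in> endos \<Longrightarrow> x \<in> X \<Longrightarrow> f x \<in> X"
  by (simp add: endos_def)

lemma endos_shift_pow:
  assumes "f \<in> endos" "x \<in> X"
  shows "f (shift_pow k x) = shift_pow k (f x)"
  using shift_pow_iterate[of f 1 x k] assms by (simp add: endos_def)

lemma endos_agree:
  assumes "f \<in> endos"
  obtains N where "0 \<le> N"
    "\<And>x y M. x \<in> X \<Longrightarrow> y \<in> X \<Longrightarrow> agree (M + N) x y \<Longrightarrow> agree M (f x) (f y)"
proof -
  obtain a b where w: "window a b f"
    using assms by (auto simp: endos_def)
  have "agree M (f x) (f y)"
    if xy: "x \<in> X" "y \<in> X" and ag: "agree (M + (\<bar>a\<bar> + \<bar>b\<bar>)) x y" for x y M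
    unfolding agree_def
  proof (intro allI impI)
    fix i :: int
    assume i: "\<bar>i\<bar> \<le> M"
    have "shift_pow i x j = shift_pow i y j" if "j \<in> {a..b}" for j
      using that i agreeD[OF ag, of "j + i"] by auto
    then have "f (shift_pow i x) 0 = f (shift_pow i y) 0"
      using w xy shift_pow_in_X unfolding window_def by blast
    then show "f x i = f y i"
      using xy by (simp add: endos_shift_pow[OF assms])
  qed
  then show ?thesis
    using that[of "\<bar>a\<bar> + \<bar>b\<bar>"] by auto
qed

text \<open>The orbit of \<open>base\<close> is dense, and commuting with the shift determines both
  maps on it.\<close>

lemma endos_eqI:
  assumes "f \<in> endos" "g \<in> endos" "f base = g base" "x \<in> X"
  shows "f x = g x"
proof (rule agree_imp_eq)
  fix M
  obtain N1 where N1: "0 \<le> N1"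
    "\<And>x y M. x \<in> X \<Longrightarrow> y \<in> X \<Longrightarrow> agree (M + N1) x y \<Longrightarrow> agree M (f x) (f y)"
    using endos_agree[OF assms(1)] by blast
  obtain N2 where N2: "0 \<le> N2"
    "\<And>x y M. x \<in> X \<Longrightarrow> y \<in> X \<Longrightarrow> agree (M + N2) x y \<Longrightarrow> agree M (g x) (g y)"
    using endos_agree[OF assms(2)] by blast
  obtain t where t: "agree (M + (N1 + N2)) x (shift_pow t base)"
    using assms(4) by (auto simp: X_def)
  have "shift_pow t base \<in> X"
    by (simp add: base_in_X shift_pow_in_X)
  then have "agree M (f x) (f (shift_pow t base))" "agree M (g x) (g (shift_pow t base))"
    using t N1 N2 assms(4) agree_mono[OF t] by auto
  moreover have "f (shift_pow t base) = g (shift_pow t base)"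
    using assms(3) base_in_X by (simp add: endos_shift_pow[OF assms(1)] endos_shift_pow[OF assms(2)])
  ultimately show "agree M (f x) (g x)"
    by (metis agree_sym agree_trans)
qed

lemma endos_cong:
  assumes "f \<in> endos" "\<And>x. x \<in> X \<Longrightarrow> g x = f x"
  shows "g \<in> endos"
proof -
  obtain N where N: "0 \<le> N"
    "\<And>x y M. x \<in> X \<Longrightarrow> y \<in> X \<Longrightarrow> agree (M + N) x y \<Longrightarrow> agree M (f x) (f y)"
    using endos_agree[OF assms(1)] by blast
  show ?thesis
  proof (rule endosI[where N = "0 + N"])
    show "g x \<in> X" "g (shift_pow 1 x) = shift_pow 1 (g x)" if "x \<in> X" for x
      using that by (simp_all add: assms(2) shift_pow_in_X endos_in_X[OF assms(1)] endos_shift_pow[OF assms(1)])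
    show "g x 0 = g y 0" if "x \<in> X" "y \<in> X" "agree (0 + N) x y" for x y
      using N(2)[OF that] that by (simp add: assms(2) agree_def)
  qed
qed

lemma shift_pow_endos: "shift_pow n \<in> endos"
proof (rule endosI[where N = "\<bar>n\<bar>"])
  show "shift_pow n (shift_pow 1 x) = shift_pow 1 (shift_pow n x)" for x
    by (simp add: fun_eq_iff algebra_simps)
  show "shift_pow n x 0 = shift_pow n y 0" if "agree \<bar>n\<bar> x y" for x y
    using that by (simp add: agree_def)
qed (rule shift_pow_in_X)

lemma comp_endos:
  assumes "f \<in> endos" "g \<in> endos"
  shows "f \<circ> g \<in> endos"
proof -
  obtain N1 where N1: "0 \<le> N1"
    "\<And>x y M. x \<in> X \<Longrightarrow> y \<in> X \<Longrightarrow> agree (M + N1) x y \<Longrightarrow> agree M (f x) (f y)"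
    using endos_agree[OF assms(1)] by blast
  obtain N2 where N2: "0 \<le> N2"
    "\<And>x y M. x \<in> X \<Longrightarrow> y \<in> X \<Longrightarrow> agree (M + N2) x y \<Longrightarrow> agree M (g x) (g y)"
    using endos_agree[OF assms(2)] by blast
  show ?thesis
  proof (rule endosI[where N = "0 + N1 + N2"])
    fix x
    assume x: "x \<in> X"
    then show "(f \<circ> g) x \<in> X"
      by (simp add: endos_in_X[OF assms(1)] endos_in_X[OF assms(2)])
    show "(f \<circ> g) (shift_pow 1 x) = shift_pow 1 ((f \<circ> g) x)"
      by (simp only: comp_apply endos_shift_pow[OF assms(2) x]
          endos_shift_pow[OF assms(1) endos_in_X[OF assms(2) x]])
    fix y
    assume y: "y \<in> X" and "agree (0 + N1 + N2) x y"
    then have "agree 0 (f (g x)) (f (g y))"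
      using x by (intro N1(2) N2(2) endos_in_X[OF assms(2)])
    then show "(f \<circ> g) x 0 = (f \<circ> g) y 0"
      by (simp add: agree_def)
  qed
qed

text \<open>Strip the phase, apply \<open>g\<close> to the hole contents, refill and shift back.
  Another choice of phase shifts the contents by some \<open>q * m\<close>, which \<open>g\<close>
  respects.\<close>

lemma endos_lift:
  assumes g: "g \<in> endos"
  obtains f where "f \<in> endos" "\<And>y. y \<in> X \<Longrightarrow> f (fill y) = shift_pow c (fill (g y))"
proof -
  obtain \<phi> where \<phi>: "\<phi> x \<in> {0..<p}" "phased M (\<phi> x) x" if "x \<in> X" for x M
    using X_phased by metis
  define f where "f x = shift_pow (c + \<phi> x) (fill (g (unfill (shift_pow (- \<phi> x) x))))" for x
  have f: "f (shift_pow e (fill y)) = shift_pow (c + e) (fill (g y))" if y: "y \<in> X" for e y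
  proof -
    define x where "x = shift_pow e (fill y)"
    have "x \<in> X"
      by (simp add: x_def y fill_in_X shift_pow_in_X)
    then have "p dvd e - \<phi> x"
      using \<phi>(2) phased_fill phased_unique x_def by metis
    then obtain m where m: "e = \<phi> x + p * m"
      by (metis diff_eq_eq add.commute dvdE)
    have "shift_pow (- \<phi> x) x = fill (shift_pow (q * m) y)"
      by (subst x_def, subst m) (simp add: fill_shift_pow flip: shift_pow_add)
    then have "f x = shift_pow (c + \<phi> x) (fill (shift_pow (q * m) (g y)))"
      using y by (simp add: f_def endos_shift_pow[OF g])
    also have "\<dots> = shift_pow (c + e) (fill (g y))"
      unfolding m fill_shift_pow by (simp add: add.assoc flip: shift_pow_add)
    finally show ?thesis
      by (simp add: x_def)
  qed
  obtain N where N: "0 \<le> N"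
    "\<And>x y M. x \<in> X \<Longrightarrow> y \<in> X \<Longrightarrow> agree (M + N) x y \<Longrightarrow> agree M (g x) (g y)"
    using endos_agree[OF g] by blast
  \<comment> \<open>Reading the contents up to \<open>\<bar>c\<bar> + p + N\<close> takes all but
    the last summand \<open>p\<close>, which pays for removing a phase \<open>e < p\<close>.\<close>
  define B where "B = p * (\<bar>c\<bar> + p + N) + p + p"
  have "f \<in> endos"
  proof (rule endosI[where N = B])
    fix x
    assume "x \<in> X"
    then obtain e y where y: "y \<in> X" "x = shift_pow e (fill y)"
      using X_decomp by blast
    show "f x \<in> X"
      using y by (simp add: f endos_in_X[OF g] fill_in_X shift_pow_in_X)
    have "shift_pow 1 x = shift_pow (1 + e) (fill y)"
      by (simp add: y(2) shift_pow_add)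
    then show "f (shift_pow 1 x) = shift_pow 1 (f x)"
      using y by (simp add: f algebra_simps flip: shift_pow_add)
  next
    fix x x'
    assume x: "x \<in> X" "x' \<in> X" and ag: "agree B x x'"
    obtain e y where y: "0 \<le> e" "e < p" "y \<in> X" "x = shift_pow e (fill y)"
      using X_decomp[OF x(1)] by blast
    obtain e' y' where y': "0 \<le> e'" "e' < p" "y' \<in> X" "x' = shift_pow e' (fill y')"
      using X_decomp[OF x(2)] by blast
    have "0 \<le> p * (\<bar>c\<bar> + p + N)"
      using p_pos N(1) by simp
    then have "agree p x x'"
      using ag p_pos by (elim agree_mono) (simp add: B_def)
    then have "phased p e x'"
      using phased_fill phased_agree y(4) by metis
    then have "p dvd e - e'"
      using phased_fill phased_unique y'(4) by metis
    then have e: "e' = e"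
      using y y' by (metis mod_eq_dvd_iff mod_pos_pos_trivial)
    have "agree (B - \<bar>- e\<bar>) (shift_pow (- e) x) (shift_pow (- e) x')"
      using ag by (intro agree_shift_pow) simp
    then have "agree (p * (\<bar>c\<bar> + p + N) + p) (fill y) (fill y')"
      using y y' e by (auto simp: B_def elim!: agree_mono)
    then have "agree (\<bar>c\<bar> + p + N) y y'"
      using agree_unfill by fastforce
    then have "agree (\<bar>c\<bar> + p) (fill (g y)) (fill (g y'))"
      using N y y' by (intro agree_fill) blast
    then show "f x 0 = f x' 0"
      using y y' e by (auto simp: f intro!: agreeD)
  qed
  moreover have "f (fill y) = shift_pow c (fill (g y))" if "y \<in> X" for y
    using f[OF that, of 0] by (simp add: shift_pow_0)
  ultimately show ?thesis
    using that by blast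
qed

text \<open>Every second position at most is a hole, so the window of an endomorphism halves when it
  is read on the hole contents.\<close>

lemma endos_descend:
  assumes f: "f \<in> endos" and w: "window a b f"
  obtains c g a' where "g \<in> endos" "\<And>y. y \<in> X \<Longrightarrow> f (fill y) = shift_pow c (fill (g y))"
    "window a' (a' + (b - a) div 2) g"
proof -
  obtain c u where c: "u \<in> X" "f base = shift_pow c (fill u)"
    using X_decomp[OF endos_in_X[OF f base_in_X]] by metis
  obtain N where N: "0 \<le> N"
    "\<And>x y M. x \<in> X \<Longrightarrow> y \<in> X \<Longrightarrow> agree (M + N) x y \<Longrightarrow> agree M (f x) (f y)"
    using endos_agree[OF f] by blast
  \<comment> \<open>The phase found at \<open>base\<close> holds for every image, since
    \<open>fill y\<close> is a limit of shifts of \<open>base\<close> by multiples of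
    \<open>p\<close>, which leave the phase alone.\<close>
  have phase: "phased M c (f (fill y))" if y: "y \<in> X" for y M
    unfolding phased_def
  proof (intro allI impI)
    fix i :: int
    assume i: "\<not> hole (i + c)"
    obtain m where m: "agree (\<bar>i\<bar> + N) y (shift_pow (q * m) base)"
      using X_approx[OF y] by blast
    have "agree \<bar>i\<bar> (f (fill y)) (f (shift_pow (p * m) base))"
      unfolding shift_pow_mult_base
      by (intro N agree_fill m fill_in_X shift_pow_in_X y base_in_X)
    then have "f (fill y) i = f base (i + p * m)"
      using base_in_X by (simp add: agree_def endos_shift_pow[OF f])
    also have "\<dots> = fill u (i + c + p * m)"
      by (simp add: c algebra_simps)
    also have "\<dots> = nat ((i + c) mod p)"
      using i by (simp add: fill_def)
    finally show "f (fill y) i = nat ((i + c) mod p)" .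
  qed
  define z where "z y = shift_pow (- c) (f (fill y))" for y
  define g where "g y = unfill (z y)" for y
  have z: "z y \<in> X" "phased M 0 (z y)" if "y \<in> X" for y M
    using that phased_shift_pow[OF phase[OF that], of M "- c"]
    by (simp_all add: z_def endos_in_X[OF f] fill_in_X shift_pow_in_X)
  have gX: "g y \<in> X" and fill_g: "fill (g y) = z y" if "y \<in> X" for y
    using z[OF that] by (simp_all add: g_def unfill_in_X fill_unfill)
  have fg: "f (fill y) = shift_pow c (fill (g y))" if "y \<in> X" for y
    by (simp add: fill_g that) (simp add: z_def)
  have ag: "agree M (g x) (g y)"
    if "x \<in> X" "y \<in> X" "agree (p * M + p + \<bar>- c\<bar> + N) x y" for x y M
    using that unfolding g_def z_def
    by (intro agree_unfill agree_shift_pow N fill_in_X agree_fill)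
  \<comment> \<open>Commutation of \<open>f\<close> with \<open>shift_pow p\<close> gives that of
    \<open>g\<close> with \<open>shift_pow q\<close> only; \<open>commute_shift\<close> supplies the
    rest.\<close>
  have comm: "g (shift_pow 1 y) = shift_pow 1 (g y)" if "y \<in> X" for y
  proof (rule commute_shift[OF gX _ _ that])
    show "\<exists>N. \<forall>y\<in>X. agree N x y \<longrightarrow> agree M (g x) (g y)" if "x \<in> X" for x M
      using ag that by blast
    show "g (shift_pow q x) = shift_pow q (g x)" if "x \<in> X" for x
    proof -
      have "f (fill (shift_pow (q * 1) x)) = shift_pow (p * 1) (f (fill x))"
        unfolding fill_shift_pow using that by (simp add: endos_shift_pow[OF f] fill_in_X)
      then have "shift_pow c (fill (g (shift_pow (q * 1) x))) = 
          shift_pow (p * 1) (shift_pow c (fill (g x)))"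
        using that by (simp add: fg shift_pow_in_X)
      also have "\<dots> = shift_pow c (fill (shift_pow (q * 1) (g x)))"
        unfolding fill_shift_pow by (simp add: add.commute flip: shift_pow_add)
      finally have "unfill (fill (g (shift_pow (q * 1) x))) = unfill (fill (shift_pow (q * 1) (g x)))"
        by simp
      then show ?thesis
        by simp
    qed
  qed
  have "g \<in> endos"
  proof (rule endosI)
    show "g x 0 = g y 0" if "x \<in> X" "y \<in> X" "agree (p * 0 + p + \<bar>- c\<bar> + N) x y" for x y
      using ag[OF that] by (simp add: agree_def)
  qed (use gX comm in auto)
  moreover
  \<comment> \<open>\<open>g y 0\<close> is the symbol of \<open>f (fill y)\<close> at
    \<open>pos 0 - c\<close>, so only \<open>fill y\<close> on the translated window matters.
    \<open>H\<close> collects the holes there; if there are none, any \<open>a'\<close>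
    works.\<close>
  define H where "H = {i \<in> {a + (pos 0 - c)..b + (pos 0 - c)}. hole i}"
  define a' where "a' = ind (Min H)"
  have H: "a' \<le> ind i \<and> ind i \<le> a' + (b - a) div 2" if "i \<in> H" for i
  proof -
    have fin: "finite H"
      unfolding H_def by (rule finite_subset[of _ "{a + (pos 0 - c)..b + (pos 0 - c)}"]) auto
    then have "Min H \<in> H" "Min H \<le> i"
      using that by (auto intro!: Min_in)
    then have "ind (Min H) \<le> ind i" "2 * (ind i - ind (Min H)) \<le> i - Min H" "i - Min H \<le> b - a"
      using that ind_gap[of "Min H" i] by (auto simp: H_def)
    moreover from this have "(2 * (ind i - ind (Min H))) div 2 \<le> (b - a) div 2"
      by (intro zdiv_mono1) linarith+
    ultimately show ?thesis
      unfolding a'_def by simp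
  qed
  have "window a' (a' + (b - a) div 2) g"
    unfolding window_def
  proof (intro ballI impI)
    fix x y
    assume xy: "x \<in> X" "y \<in> X" and eq: "\<forall>i\<in>{a'..a' + (b - a) div 2}. x i = y i"
    have "shift_pow (pos 0 - c) (fill x) i = shift_pow (pos 0 - c) (fill y) i" if "i \<in> {a..b}" for i
      using eq H[of "i + (pos 0 - c)"] that by (auto simp: fill_def H_def)
    then have "f (shift_pow (pos 0 - c) (fill x)) 0 = f (shift_pow (pos 0 - c) (fill y)) 0"
      using w xy unfolding window_def by (simp add: fill_in_X shift_pow_in_X)
    moreover have "f (shift_pow (pos 0 - c) (fill x)) 0 = g x 0" if "x \<in> X" for x
      using that by (simp add: endos_shift_pow[OF f] fill_in_X g_def unfill_def z_def)
    ultimately show "g x 0 = g y 0"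
      using xy by simp
  qed
  ultimately show ?thesis
    using that fg by blast
qed

section \<open>Endomorphisms with a window of one position\<close>

lemma exists_filled_to_hole:
  assumes "\<not> p dvd c"
  shows "\<exists>r. \<not> hole r \<and> hole (r + c)"
proof (cases "hole (1 - c)")
  case False
  have "hole 1"
    using q_pos two_q_less by (simp add: hole_def mod_pos_pos_trivial)
  then show ?thesis
    using False by (intro exI[of _ "1 - c"]) simp
next
  case True
  define s where "s = (1 - c) mod p"
  have s: "odd s" "s < 2 * q" "0 \<le> s"
    using True p_pos by (simp_all add: hole_def s_def)
  have "s \<noteq> 1"
  proof
    assume "s = 1"
    then have "(1 - c) mod p = 1 mod p"
      using q_pos two_q_less by (simp add: s_def mod_pos_pos_trivial)
    then have "p dvd (1 - c) - 1"
      by (simp only: mod_eq_dvd_iff)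
    then show False
      using assms by simp
  qed
  then have s3: "3 \<le> s"
    using s by presburger
  \<comment> \<open>The first odd position beyond the holes is filled, even for
    \<open>p = 2 * q + 1\<close>, where its residue is \<open>0\<close>. Moving it by
    \<open>c\<close> gives the residue \<open>2 * q + 2 - s\<close>, which is odd and below
    \<open>2 * q\<close>.\<close>
  have "\<not> hole (2 * q + 1)"
  proof (cases "p = 2 * q + 1")
    case True
    then have "(2 * q + 1) mod p = 0"
      by simp
    then show ?thesis
      by (simp add: hole_def)
  next
    case False
    then show ?thesis
      using two_q_less q_pos by (simp add: hole_def mod_pos_pos_trivial)
  qed
  moreover have "hole (2 * q + 1 + c)"
  proof -
    have "(2 * q + 1 + c) mod p = (2 * q + 2 - s) mod p"
      unfolding s_def mod_diff_right_eq by (simp add: algebra_simps)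
    also have "\<dots> = 2 * q + 2 - s"
      using s s3 two_q_less by (simp add: mod_pos_pos_trivial)
    finally show ?thesis
      using s s3 by (simp add: hole_def)
  qed
  ultimately show ?thesis
    by blast
qed

lemma base_filled: "\<not> hole i \<Longrightarrow> base i = nat (i mod p)"
  by (simp add: base.simps)

lemma base_symbol: "\<exists>j. \<not> hole j \<and> base i = base j"
proof (induction i rule: base.induct)
  case (1 i)
  then show ?case
    by (cases "hole i") (use base.simps[of i] in auto)
qed

text \<open>\<open>h\<close> acts letter by letter. An offset \<open>c\<close> not divisible by
  \<open>p\<close> would make a point of \<open>X\<close> constant along a progression of step
  \<open>q\<close>, contrary to its varying filled symbols. Otherwise \<open>h\<close> preserves all
  filled symbols, and every letter occurs as one.\<close>

lemma symbol_map_trivial: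
  assumes h: "h \<in> endos" and w: "window 0 0 h"
  shows "h base = base"
proof -
  have letter: "h base i = h base j" if "base i = base j" for i j
  proof -
    have "h (shift_pow i base) 0 = h (shift_pow j base) 0"
      using w that by (simp add: window_def base_in_X shift_pow_in_X)
    then show ?thesis
      by (simp add: endos_shift_pow[OF h base_in_X])
  qed
  obtain c g where g: "g \<in> endos" "\<And>y. y \<in> X \<Longrightarrow> h (fill y) = shift_pow c (fill (g y))"
    using endos_descend[OF h w] by metis
  define y where "y = g base"
  have y: "y \<in> X" "h base = shift_pow c (fill y)"
    using g(2)[OF base_in_X] endos_in_X[OF g(1) base_in_X] by (simp_all add: y_def fill_base)
  have "p dvd c"
  proof (rule ccontr)
    assume "\<not> p dvd c"
    then obtain r where r: "\<not> hole r" "hole (r + c)"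
      using exists_filled_to_hole by blast
    have const: "y (ind (r + c) + q * m) = h base r" for m
    proof -
      have "base (r + p * m) = base r"
        using r(1) by (simp add: base_filled)
      then have "h base r = h base (r + p * m)"
        by (rule letter[symmetric])
      also have "\<dots> = fill y (r + c + p * m)"
        by (simp add: y algebra_simps)
      also have "\<dots> = y (ind (r + c) + q * m)"
        using r(2) by (simp add: fill_def ind_add_mult)
      finally show ?thesis ..
    qed
    obtain d where d: "phased M d y" for M
      using X_phased[OF y(1)] by blast
    have filled: "y i = nat ((i + d) mod p)" if "\<not> hole (i + d)" for i
      using d[of "\<bar>i\<bar>"] that by (simp add: phased_def)
    have coprime': "coprime q p"
      using coprime by (simp add: ac_simps)
    \<comment> \<open>As \<open>q\<close> is prime to \<open>p\<close>, the progression meets every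
      residue of the phase of \<open>y\<close>, so its constant value would equal every filled
      symbol, in particular \<open>0\<close> and \<open>p - 1\<close>.\<close>
    have reach: "h base r = nat e" if e: "0 \<le> e" "e < p" "\<not> hole e" for e
    proof -
      obtain s where s: "p dvd ind (r + c) + d + q * s - e"
        using exists_mult_cong[OF coprime'] by blast
      then have "(ind (r + c) + q * s + d) mod p = e mod p"
        by (simp add: mod_eq_dvd_iff algebra_simps)
      then have "(ind (r + c) + q * s + d) mod p = e"
        using e by (simp add: mod_pos_pos_trivial)
      then show ?thesis
        using filled[of "ind (r + c) + q * s"] e const[of s] by (simp add: hole_def)
    qed
    have "(p - 1) mod p = p - 1"
      using p_pos by (intro mod_pos_pos_trivial) auto
    then have "\<not> hole (p - 1)" "\<not> hole 0"
      using two_q_less by (simp_all only: hole_def) auto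
    then have "nat 0 = nat (p - 1)"
      using reach[of 0] reach[of "p - 1"] p_pos by simp
    then show False
      using two_q_less q_pos by linarith
  qed
  then obtain m where m: "c = p * m"
    by auto
  have filled: "h base i = base i" if "\<not> hole i" for i
    using that by (simp add: y m base_filled fill_def)
  show ?thesis
  proof
    fix i
    obtain j where "\<not> hole j" "base i = base j"
      using base_symbol by blast
    then show "h base i = base i"
      using letter filled by metis
  qed
qed

lemma window_singleton:
  assumes f: "f \<in> endos" and w: "window a a f" and x: "x \<in> X"
  shows "f x = shift_pow a x"
proof -
  define h where "h = shift_pow (- a) \<circ> f"
  have h: "h \<in> endos"
    unfolding h_def by (rule comp_endos[OF shift_pow_endos f])
  have "window 0 0 h"
    unfolding window_def
  proof (intro ballI impI)
    fix x y
    assume xy: "x \<in> X" "y \<in> X" and eq: "\<forall>i\<in>{0..0}. x i = y i"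
    have "\<forall>i\<in>{a..a}. shift_pow (- a) x i = shift_pow (- a) y i"
      using eq by simp
    then have "f (shift_pow (- a) x) 0 = f (shift_pow (- a) y) 0"
      using w xy shift_pow_in_X unfolding window_def by blast
    then show "h x 0 = h y 0"
      by (simp add: h_def endos_shift_pow[OF f xy(1)] endos_shift_pow[OF f xy(2)])
  qed
  then have "h base = base"
    by (rule symbol_map_trivial[OF h])
  moreover have "f base = shift_pow a (h base)"
    by (simp add: h_def)
  ultimately have "f base = shift_pow a base"
    by simp
  then show ?thesis
    by (rule endos_eqI[OF f shift_pow_endos _ x])
qed

section \<open>Endomorphisms as rational translations\<close>

text \<open>\<open>represents f r\<close>: the endomorphism \<open>f\<close> translates the odometer by \<open>r\<close>. Applying \<open>g\<close> to the
  hole contents multiplies the translation by \<open>p / q\<close>, since \<open>\<sigma>\<^sup>q\<close> there is \<open>\<sigma>\<^sup>p\<close> outside.\<close>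

inductive represents :: "((int \<Rightarrow> nat) \<Rightarrow> (int \<Rightarrow> nat)) \<Rightarrow> rat \<Rightarrow> bool" where
  shift: "f \<in> endos \<Longrightarrow> (\<And>x. x \<in> X \<Longrightarrow> f x = shift_pow n x) \<Longrightarrow> represents f (of_int n)"
| lift: "represents g r \<Longrightarrow> f \<in> endos \<Longrightarrow>
    (\<And>y. y \<in> X \<Longrightarrow> f (fill y) = shift_pow c (fill (g y))) \<Longrightarrow>
    represents f (of_int c + of_int p / of_int q * r)"

lemma represents_endos: "represents f r \<Longrightarrow> f \<in> endos"
  by (erule represents.cases) auto

lemma represents_cong:
  assumes "represents f r" "\<And>x. x \<in> X \<Longrightarrow> h x = f x"
  shows "represents h r"
proof -
  have h: "h \<in> endos"
    using assms represents_endos endos_cong by blast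
  show ?thesis
    using assms(1)
  proof cases
    case (shift n)
    show ?thesis
      unfolding shift(1) by (rule represents.shift[OF h]) (simp only: assms(2) shift(3))
  next
    case (lift g r' c)
    show ?thesis
      unfolding lift(1)
      by (rule represents.lift[OF lift(2) h]) (simp only: assms(2) fill_in_X lift(4))
  qed
qed

lemma represents_shift_comp:
  assumes "represents f r"
  shows "represents (shift_pow n \<circ> f) (of_int n + r)"
proof -
  have h: "shift_pow n \<circ> f \<in> endos"
    using represents_endos[OF assms] by (rule comp_endos[OF shift_pow_endos])
  show ?thesis
    using assms
  proof cases
    case (shift m)
    have "represents (shift_pow n \<circ> f) (of_int (n + m))"
      by (rule represents.shift[OF h]) (simp only: comp_apply shift(3) shift_pow_add)
    then show ?thesis
      using shift by simp
  next
    case (lift g r' c)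
    have "represents (shift_pow n \<circ> f) (of_int (n + c) + of_int p / of_int q * r')"
      by (rule represents.lift[OF lift(2) h]) (simp only: comp_apply lift(4) shift_pow_add)
    then show ?thesis
      using lift by (simp add: add.assoc)
  qed
qed

text \<open>For two lifts the offsets add up and the inner maps compose; if one map is a shift,
  commutation reduces the case to \<open>represents_shift_comp\<close>.\<close>

lemma represents_comp:
  assumes "represents f r" "represents h s"
  shows "represents (f \<circ> h) (r + s)"
  using assms
proof (induction arbitrary: h s rule: represents.induct)
  case (shift f n)
  have "represents (shift_pow n \<circ> h) (of_int n + s)"
    by (rule represents_shift_comp[OF shift.prems])
  then show ?case
    by (rule represents_cong)
      (simp only: comp_apply shift.hyps(2)[OF endos_in_X[OF represents_endos[OF shift.prems]]])
next
  case (lift g r f c)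
  have fh: "f \<circ> h \<in> endos"
    by (rule comp_endos[OF lift.hyps(2) represents_endos[OF lift.prems]])
  note fs = endos_shift_pow[OF lift.hyps(2)]
  show ?case
    using lift.prems
  proof cases
    case (shift n)
    have "represents (shift_pow n \<circ> f) (of_int n + (of_int c + of_int p / of_int q * r))"
      by (rule represents_shift_comp) (rule represents.lift[OF lift.hyps])
    then have "represents (f \<circ> h) (of_int n + (of_int c + of_int p / of_int q * r))"
      by (rule represents_cong) (simp add: shift(3) fs)
    then show ?thesis
      by (simp only: shift(1) add.commute)
  next
    case (lift g' s' d)
    have g': "g' y \<in> X" if "y \<in> X" for y
      using endos_in_X[OF represents_endos[OF lift(2)] that] .
    have "represents (f \<circ> h) (of_int (c + d) + of_int p / of_int q * (r + s'))"
    proof (rule represents.lift[OF lift.IH[OF lift(2)] fh])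
      fix y
      assume y: "y \<in> X"
      have "(f \<circ> h) (fill y) = shift_pow d (f (fill (g' y)))"
        using y g' by (simp add: lift(4) fs fill_in_X)
      also have "\<dots> = shift_pow (c + d) (fill ((g \<circ> g') y))"
        using y g' by (simp add: \<open>\<And>y. y \<in> X \<Longrightarrow> f (fill y) = shift_pow c (fill (g y))\<close> add.commute
            flip: shift_pow_add)
      finally show "(f \<circ> h) (fill y) = shift_pow (c + d) (fill ((g \<circ> g') y))" .
    qed
    moreover have "of_int (c + d) + of_int p / of_int q * (r + s') =
        of_int c + of_int p / of_int q * r + s"
      by (simp add: lift(1) algebra_simps add_divide_distrib)
    ultimately show ?thesis
      by (simp only:)
  qed
qed

lemma represents_uminus:
  assumes "represents f r"
  shows "\<exists>h. represents h (- r)"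
  using assms
proof (induction rule: represents.induct)
  case (shift f n)
  have "represents (shift_pow (- n)) (of_int (- n))"
    by (intro represents.shift shift_pow_endos refl)
  then show ?case
    by auto
next
  case (lift g r f c)
  then obtain h where h: "represents h (- r)"
    by blast
  obtain f' where "f' \<in> endos" "\<And>y. y \<in> X \<Longrightarrow> f' (fill y) = shift_pow (- c) (fill (h y))"
    using endos_lift[OF represents_endos[OF h]] by blast
  then have "represents f' (of_int (- c) + of_int p / of_int q * (- r))"
    by (intro represents.lift[OF h])
  then show ?case
    by (auto simp: algebra_simps)
qed

lemma represents_denominator:
  assumes "represents f r"
  shows "\<exists>a k. r * of_int (q ^ k) = of_int a"
  using assms
proof (induction rule: represents.induct)
  case (shift f n)
  then show ?case
    by (intro exI[of _ n] exI[of _ 0]) simp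
next
  case (lift g r f c)
  then obtain a k where "r * of_int (q ^ k) = of_int a"
    by blast
  then have "(of_int c + of_int p / of_int q * r) * of_int (q ^ Suc k) = of_int (c * q ^ Suc k + p * a)"
    using q_pos by (simp add: field_simps)
  then show ?case
    by blast
qed

text \<open>For a lift, the denominator of the inner \<open>r\<close> is a power of
  \<open>q\<close>, so coprimality forces \<open>p dvd n - c\<close>. Then \<open>r = q * m\<close>,
  the inner map shifts by \<open>q * m\<close>, and filling turns this into a shift by
  \<open>p * m\<close>.\<close>

lemma represents_of_int:
  assumes "represents f r" "r = of_int n" "x \<in> X"
  shows "f x = shift_pow n x"
  using assms
proof (induction arbitrary: n x rule: represents.induct)
  case (shift f m)
  then show ?case
    by simp
next
  case (lift g r f c)
  obtain a k where a: "r * of_int (q ^ k) = of_int a"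
    using represents_denominator[OF lift.hyps(1)] by blast
  have r: "of_int p * r = of_int ((n - c) * q)"
    using lift.prems(1) q_pos by (simp add: field_simps)
  have "of_int (p * a) = (of_int p * r) * (of_int (q ^ k) :: rat)"
    unfolding of_int_mult[of p a] a[symmetric] by simp
  also have "\<dots> = of_int ((n - c) * q ^ Suc k)"
    unfolding r by simp
  finally have "p * a = (n - c) * q ^ Suc k"
    by (simp only: of_int_eq_iff)
  then have "p dvd (n - c) * q ^ Suc k"
    by (metis dvd_triv_left)
  then have "p dvd n - c"
    using coprime by (metis coprime_dvd_mult_left_iff coprime_power_right_iff)
  then obtain m where m: "n = c + p * m"
    by (metis diff_eq_eq add.commute dvdE)
  have "of_int p * r = of_int p * of_int (q * m)"
    unfolding r m by simp
  then have "r = of_int (q * m)"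
    using p_pos by (simp only: mult_cancel_left of_int_eq_0_iff) auto
  then have "g base = shift_pow (q * m) base"
    by (rule lift.IH[OF _ base_in_X])
  then have "f (fill base) = shift_pow n (fill base)"
    by (simp add: lift.hyps(3)[OF base_in_X] fill_shift_pow m flip: shift_pow_add)
  then show ?case
    using endos_eqI[OF lift.hyps(2) shift_pow_endos _ lift.prems(2)] by (simp add: fill_base)
qed

text \<open>Infinite descent: a period is a multiple \<open>p * m\<close> by uniqueness of the
  phase, and the hole contents then have the smaller period \<open>q * m\<close>.\<close>

lemma base_aperiodic: "shift_pow n base = base \<Longrightarrow> n = 0"
proof (induction "nat \<bar>n\<bar>" arbitrary: n rule: less_induct)
  case less
  have "shift_pow 0 (fill base) = shift_pow n (fill base)"
    using less.prems by (simp add: fill_base shift_pow_0)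
  then obtain m where m: "n = 0 + p * m" "base = shift_pow (q * m) base"
    using shift_pow_fill_inject[OF base_in_X] by metis
  show ?case
  proof (rule ccontr)
    assume "n \<noteq> 0"
    then have "m \<noteq> 0"
      using m by auto
    then have "q * \<bar>m\<bar> < p * \<bar>m\<bar>"
      using two_q_less q_pos by (intro mult_strict_right_mono) auto
    moreover have "0 \<le> q * \<bar>m\<bar>"
      using q_pos by simp
    ultimately have "nat \<bar>q * m\<bar> < nat \<bar>n\<bar>"
      unfolding m(1) using p_pos q_pos by (simp only: abs_mult)
    then have "q * m = 0"
      by (rule less.hyps[OF _ m(2)[symmetric]])
    then show False
      using \<open>m \<noteq> 0\<close> q_pos by simp
  qed
qed

text \<open>Rests on aperiodicity of \<open>base\<close> for shifts and on unique decomposition for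
  lifts.\<close>

lemma represents_shift_pow:
  assumes "represents f r" "f base = shift_pow n base"
  shows "r = of_int n"
  using assms
proof (induction arbitrary: n rule: represents.induct)
  case (shift f m)
  then have eq: "shift_pow m base = shift_pow n base"
    using base_in_X by metis
  have "shift_pow (m - n) base = shift_pow (- n) (shift_pow m base)"
    by (simp flip: shift_pow_add)
  also have "\<dots> = base"
    by (simp only: eq shift_pow_inverse)
  finally show ?case
    using base_aperiodic by fastforce
next
  case (lift g r f c)
  have "shift_pow n (fill base) = shift_pow c (fill (g base))"
    using lift.prems lift.hyps(3)[OF base_in_X] unfolding fill_base by metis
  then obtain m where m: "n = c + p * m" "g base = shift_pow (q * m) base"
    using shift_pow_fill_inject[OF base_in_X] by metis
  then show ?case
    using lift.IH[OF m(2)] q_pos by (simp add: m(1))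
qed

text \<open>With \<open>h\<close> for \<open>- s\<close>, the composite represents \<open>0\<close>
  and so fixes \<open>base\<close>; as it also represents \<open>r - s\<close>, this difference
  vanishes.\<close>

lemma represents_unique:
  assumes "represents f r" "represents f s"
  shows "r = s"
proof -
  obtain h where h: "represents h (- s)"
    using represents_uminus[OF assms(2)] by blast
  have "represents (f \<circ> h) (s + - s)" "represents (f \<circ> h) (r + - s)"
    by (intro represents_comp assms h)+
  moreover from this(1) have "(f \<circ> h) base = shift_pow 0 base"
    by (rule represents_of_int) (simp_all add: base_in_X)
  ultimately have "r + - s = of_int 0"
    using represents_shift_pow by blast
  then show ?thesis
    by simp
qed

text \<open>With \<open>h\<close> for \<open>- r\<close>, both \<open>f \<circ> h\<close> and
  \<open>h \<circ> g\<close> represent \<open>0\<close>, hence are the identity on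
  \<open>X\<close>.\<close>

lemma represents_eq:
  assumes "represents f r" "represents g r" "x \<in> X"
  shows "f x = g x"
proof -
  obtain h where h: "represents h (- r)"
    using represents_uminus[OF assms(1)] by blast
  have id: "u y = y" if "represents u 0" "y \<in> X" for u y
    using represents_of_int[OF that(1), of 0 y] that(2) by (simp add: shift_pow_0)
  have fh: "(f \<circ> h) y = y" if "y \<in> X" for y
    using id[OF represents_comp[OF assms(1) h, unfolded add.right_inverse] that] .
  have hg: "(h \<circ> g) y = y" if "y \<in> X" for y
    using id[OF represents_comp[OF h assms(2), unfolded add.left_inverse] that] .
  show ?thesis
    using fh[of "g x"] hg[of x] assms(3) endos_in_X[OF represents_endos[OF assms(2)] assms(3)]
    by simp
qed

text \<open>Descent on the window length, which each passage to the hole contents at least halves,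
  down to the shifts of \<open>window_singleton\<close>.\<close>

lemma represents_exists:
  assumes "f \<in> endos"
  shows "\<exists>r. represents f r"
proof -
  have "\<exists>r. represents f r" if "f \<in> endos" "window a (a + int L) f" for f a L
    using that
  proof (induction L arbitrary: a f rule: less_induct)
    case (less L)
    show ?case
    proof (cases "L = 0")
      case True
      then have "window a a f"
        using less.prems(2) by simp
      then show ?thesis
        using represents.shift[OF less.prems(1) window_singleton[OF less.prems(1)]] by blast
    next
      case False
      obtain c g a' where g: "g \<in> endos" "\<And>y. y \<in> X \<Longrightarrow> f (fill y) = shift_pow c (fill (g y))"
        "window a' (a' + (a + int L - a) div 2) g"
        using endos_descend[OF less.prems] by metis
      have "(a + int L - a) div 2 = int (L div 2)"
        by simp
      then have "window a' (a' + int (L div 2)) g"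
        using g(3) by (simp only:)
      moreover have "L div 2 < L"
        using False by simp
      ultimately obtain r where "represents g r"
        using less.IH[OF _ g(1)] by blast
      then show ?thesis
        using represents.lift[OF _ less.prems(1) g(2)] by blast
    qed
  qed
  moreover obtain a b where "window a b f"
    using assms by (auto simp: endos_def)
  \<comment> \<open>For \<open>b < a\<close> the truncation by \<open>nat\<close> enlarges the empty
    window to one position.\<close>
  then have "window a (a + int (nat (b - a))) f"
    using window_mono[of a b] by simp
  ultimately show ?thesis
    using assms by blast
qed

section \<open>Continuity and the isomorphism\<close>

abbreviation symbols :: "nat set" where
  "symbols \<equiv> {..<nat p}"

lemma base_less: "base i \<in> symbols"
  using base_symbol[of i] base_filled p_pos by (auto simp: nat_less_eq_zless)

lemma base_topspace: "shift_pow k base \<in> topspace (full_shift symbols)"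
  using base_less by (auto simp: topspace_full_shift)

lemma X_topspace: "X \<subseteq> topspace (full_shift symbols)"
proof
  fix x
  assume x: "x \<in> X"
  have "x i \<in> symbols" for i
  proof -
    obtain t where "agree \<bar>i\<bar> x (shift_pow t base)"
      using x by (auto simp: X_def)
    then have "x i = base (i + t)"
      by (auto dest: agreeD)
    then show ?thesis
      using base_less by simp
  qed
  then show "x \<in> topspace (full_shift symbols)"
    by (auto simp: topspace_full_shift)
qed

lemma X_closure: "X = full_shift symbols closure_of range (\<lambda>i. shift_pow i base)"
proof
  show "X \<subseteq> full_shift symbols closure_of range (\<lambda>i. shift_pow i base)"
  proof
    fix x
    assume x: "x \<in> X"
    have "\<exists>y\<in>range (\<lambda>i. shift_pow i base). y \<in> U" if U: "x \<in> U" "openin (full_shift symbols) U" for U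
    proof -
      obtain N where N: "\<And>y. y \<in> topspace (full_shift symbols) \<Longrightarrow> agree N x y \<Longrightarrow> y \<in> U"
        using openin_full_shift_contains_agree[OF U(2,1)] by blast
      obtain t where "agree N x (shift_pow t base)"
        using x by (auto simp: X_def)
      then show ?thesis
        using N base_topspace by blast
    qed
    then show "x \<in> full_shift symbols closure_of range (\<lambda>i. shift_pow i base)"
      using x X_topspace by (auto simp: in_closure_of)
  qed
  show "full_shift symbols closure_of range (\<lambda>i. shift_pow i base) \<subseteq> X"
  proof
    fix x
    assume x: "x \<in> full_shift symbols closure_of range (\<lambda>i. shift_pow i base)"
    have "\<exists>t. agree N x (shift_pow t base)" for N
    proof -
      define U where "U = {y \<in> topspace (full_shift symbols). agree N x y}"
      have "x \<in> U"
        using x by (simp add: in_closure_of agree_def U_def)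
      moreover have "openin (full_shift symbols) U"
        unfolding U_def by (rule openin_full_shift_agree)
      ultimately obtain y where "y \<in> range (\<lambda>i. shift_pow i base)" "y \<in> U"
        using x unfolding in_closure_of by meson
      then show ?thesis
        by (auto simp: U_def)
    qed
    then show "x \<in> X"
      by (simp add: X_def)
  qed
qed

lemma toeplitz_subshift_X: "toeplitz_subshift symbols X"
proof -
  have "\<exists>r>0. \<forall>k. base (i + k * r) = base i" for i
    using base_periodic[of i] p_pos by (metis mult.commute zero_less_power)
  then have "toeplitz_point symbols base"
    using base_topspace[of 0] by (simp add: toeplitz_point_def shift_pow_0)
  then show ?thesis
    using X_closure unfolding toeplitz_subshift_def by blast
qed

lemma topspace_subtopology_X: "topspace (subtopology (full_shift symbols) X) = X"
  using X_topspace by auto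

lemma continuous_map_endos:
  assumes f: "f \<in> endos"
  shows "continuous_map (subtopology (full_shift symbols) X) (subtopology (full_shift symbols) X) f"
proof -
  obtain N where N: "0 \<le> N"
    "\<And>x y M. x \<in> X \<Longrightarrow> y \<in> X \<Longrightarrow> agree (M + N) x y \<Longrightarrow> agree M (f x) (f y)"
    using endos_agree[OF f] by blast
  have "openin (subtopology (full_shift symbols) X) {x \<in> X. f x \<in> U}"
    if U: "openin (full_shift symbols) U" for U
  proof (subst openin_subopen, intro ballI)
    fix x
    assume x: "x \<in> {x \<in> X. f x \<in> U}"
    then have fx: "f x \<in> U"
      by simp
    obtain M where M: "\<And>y. y \<in> topspace (full_shift symbols) \<Longrightarrow> agree M (f x) y \<Longrightarrow> y \<in> U"
      using openin_full_shift_contains_agree[OF U fx] by blast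
    let ?V = "{y \<in> topspace (full_shift symbols). agree (M + N) x y} \<inter> X"
    have "openin (subtopology (full_shift symbols) X) ?V"
      using openin_full_shift_agree by (auto simp: openin_subtopology)
    moreover have "x \<in> ?V"
      using x X_topspace by (auto simp: agree_def)
    moreover have "?V \<subseteq> {x \<in> X. f x \<in> U}"
      using x M N(2) endos_in_X[OF f] X_topspace by blast
    ultimately show "\<exists>V. openin (subtopology (full_shift symbols) X) V \<and> x \<in> V \<and> V \<subseteq> {x \<in> X. f x \<in> U}"
      by blast
  qed
  then have "continuous_map (subtopology (full_shift symbols) X) (full_shift symbols) f"
    using endos_in_X[OF f] X_topspace unfolding continuous_map_def topspace_subtopology_X by blast
  then show ?thesis
    using endos_in_X[OF f] by (auto simp: continuous_map_in_subtopology)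
qed

text \<open>The Curtis-Hedlund-Lyndon argument: continuity gives each point a radius that decides
  coordinate \<open>0\<close>, and compactness of \<open>X\<close> leaves finitely many
  radii.\<close>

lemma continuous_imp_endos:
  assumes fX: "\<And>x. x \<in> X \<Longrightarrow> f x \<in> X"
    and cont: "continuous_map (subtopology (full_shift symbols) X) (subtopology (full_shift symbols) X) f"
    and comm: "\<And>x. x \<in> X \<Longrightarrow> f (shift x) = shift (f x)"
  shows "f \<in> endos"
proof -
  let ?T = "full_shift symbols"
  have "\<exists>N. \<forall>y\<in>X. agree N x y \<longrightarrow> f y 0 = f x 0" if x: "x \<in> X" for x
  proof -
    have "continuous_map (subtopology ?T X) ?T f"
      using cont by (simp add: continuous_map_in_subtopology)
    then have "openin (subtopology ?T X) {y \<in> X. f y \<in> {z \<in> topspace ?T. agree 0 (f x) z}}"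
      using openin_full_shift_agree unfolding continuous_map_def topspace_subtopology_X by blast
    then obtain U where U: "openin ?T U"
      "{y \<in> X. f y \<in> {z \<in> topspace ?T. agree 0 (f x) z}} = U \<inter> X"
      by (auto simp: openin_subtopology)
    have "f x \<in> topspace ?T" "agree 0 (f x) (f x)"
      using fX[OF x] X_topspace by (auto simp: agree_def)
    then have "x \<in> U"
      using x U(2) by blast
    then obtain N where "\<And>y. y \<in> topspace ?T \<Longrightarrow> agree N x y \<Longrightarrow> y \<in> U"
      using openin_full_shift_contains_agree[OF U(1)] by blast
    then have "agree 0 (f x) (f y)" if "y \<in> X" "agree N x y" for y
      using that U(2) X_topspace by blast
    then show ?thesis
      by (metis abs_0 agreeD order_refl)
  qed
  then obtain \<nu> where \<nu>: "f y 0 = f x 0" if "x \<in> X" "y \<in> X" "agree (\<nu> x) x y" for x y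
    by metis
  define C where "C x = {y \<in> topspace ?T. agree (\<nu> x) x y}" for x
  have "compactin ?T X"
    using compact_space_full_shift[of symbols] closedin_compact_space[of ?T X] X_closure
    by (metis closedin_closure_of finite_lessThan)
  moreover have "openin ?T V" if "V \<in> C ` X" for V
    using that openin_full_shift_agree by (auto simp: C_def)
  moreover have "X \<subseteq> \<Union> (C ` X)"
    using X_topspace by (auto simp: C_def agree_def)
  ultimately obtain \<F> where \<F>: "finite \<F>" "\<F> \<subseteq> C ` X" "X \<subseteq> \<Union> \<F>"
    unfolding compactin_def by (metis (no_types, lifting))
  then obtain F where F: "finite F" "F \<subseteq> X" "\<F> = C ` F"
    by (metis finite_subset_image)
  define N where "N = Max (insert 0 (\<nu> ` F))"
  show ?thesis
  proof (rule endosI[where N = N])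
    show "f (shift_pow 1 x) = shift_pow 1 (f x)" if "x \<in> X" for x
      using comm[OF that] by (simp only: shift_pow_1)
    show "f x 0 = f y 0" if xy: "x \<in> X" "y \<in> X" "agree N x y" for x y
    proof -
      obtain z where z: "z \<in> F" "agree (\<nu> z) z x"
        using xy \<F>(3) F(3) by (auto simp: C_def)
      then have "\<nu> z \<le> N"
        unfolding N_def using F(1) by (intro Max_ge) auto
      then have "agree (\<nu> z) z y"
        using z(2) agree_mono[OF xy(3)] agree_trans by blast
      then show ?thesis
        using \<nu> z xy F(2) by (metis subsetD)
    qed
  qed (rule fX)
qed

section \<open>The group \<open>A(p, q)\<close> as the set of represented translations\<close>

abbreviation ratio :: rat where
  "ratio \<equiv> of_nat (nat p) / of_nat (nat q)"

lemma ratio: "ratio = of_int p / of_int q"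
  using p_pos q_pos by simp

lemma carrier_A_group:
  "carrier (A_group (nat p) (nat q)) = generate rat_add_group (range (\<lambda>i::nat. ratio ^ i))"
  unfolding A_group_def carrier_subgroup_generated by (simp add: rat_add_group_def)

lemma A_group_add: "r \<in> carrier (A_group (nat p) (nat q)) \<Longrightarrow> s \<in> carrier (A_group (nat p) (nat q)) \<Longrightarrow>
    r + s \<in> carrier (A_group (nat p) (nat q))"
  unfolding carrier_A_group using generate.eng[of r rat_add_group _ s]
  by (simp add: rat_add_group_def)

lemma A_group_uminus: "r \<in> carrier (A_group (nat p) (nat q)) \<Longrightarrow> - r \<in> carrier (A_group (nat p) (nat q))"
  unfolding carrier_A_group
  using group.generate_m_inv_closed[OF group_rat_add_group, of "range (\<lambda>i::nat. ratio ^ i)" r]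
  by (simp add: inv_rat_add_group) (simp add: rat_add_group_def)

lemma A_group_power: "ratio ^ i \<in> carrier (A_group (nat p) (nat q))"
  unfolding carrier_A_group by (intro generate.incl) auto

lemma A_group_of_int: "of_int n \<in> carrier (A_group (nat p) (nat q))"
proof (induction n rule: int_induct[where k = 0])
  case base
  have "\<one>\<^bsub>rat_add_group\<^esub> \<in> carrier (A_group (nat p) (nat q))"
    unfolding carrier_A_group by (rule generate.one)
  then show ?case
    by (simp add: rat_add_group_def)
next
  case (step1 i)
  then show ?case
    using A_group_add[OF _ A_group_power[of 0]] by simp
next
  case (step2 i)
  then show ?case
    using A_group_add[OF _ A_group_uminus[OF A_group_power[of 0]]] by fastforce
qed

text \<open>Multiplication by \<open>ratio\<close> sends each generator to the next one; this
  matches the lifting step of \<open>represents\<close>.\<close>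

lemma A_group_ratio_mult:
  "r \<in> carrier (A_group (nat p) (nat q)) \<Longrightarrow> ratio * r \<in> carrier (A_group (nat p) (nat q))"
  unfolding carrier_A_group
proof (induction rule: generate.induct)
  case one
  have "ratio * \<one>\<^bsub>rat_add_group\<^esub> = \<one>\<^bsub>rat_add_group\<^esub>"
    by (simp add: rat_add_group_def)
  then show ?case
    by (simp only: generate.one)
next
  case (incl h)
  then obtain i where "h = ratio ^ i"
    by blast
  then have "ratio * h = ratio ^ Suc i"
    by simp
  then show ?case
    using A_group_power[of "Suc i"] by (simp only: carrier_A_group)
next
  case (inv h)
  then obtain i where "h = ratio ^ i"
    by blast
  then have "ratio * inv\<^bsub>rat_add_group\<^esub> h = - (ratio ^ Suc i)"
    by (simp add: inv_rat_add_group)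
  then show ?case
    using A_group_uminus[OF A_group_power[of "Suc i"]] by (simp only: carrier_A_group)
next
  case (eng h1 h2)
  have "ratio * (h1 \<otimes>\<^bsub>rat_add_group\<^esub> h2) = ratio * h1 + ratio * h2"
    by (simp add: rat_add_group_def distrib_left del: times_divide_eq_left)
  then show ?case
    using A_group_add eng.IH unfolding carrier_A_group by metis
qed

lemma represents_A_group: "represents f r \<Longrightarrow> r \<in> carrier (A_group (nat p) (nat q))"
proof (induction rule: represents.induct)
  case (shift f n)
  show ?case
    by (rule A_group_of_int)
next
  case (lift g r f c)
  then show ?case
    unfolding ratio[symmetric] by (intro A_group_add A_group_of_int A_group_ratio_mult)
qed

text \<open>Lifting \<open>shift_pow 1\<close> repeatedly with offset \<open>0\<close> realises the
  powers of \<open>ratio\<close>; negatives and composites give the rest.\<close>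

lemma A_group_represents: "r \<in> carrier (A_group (nat p) (nat q)) \<Longrightarrow> \<exists>f. represents f r"
  unfolding carrier_A_group
proof (induction rule: generate.induct)
  case one
  have "represents (shift_pow 0) (of_int 0)"
    by (rule represents.shift[OF shift_pow_endos refl])
  then show ?case
    by (auto simp: rat_add_group_def)
next
  have pow: "\<exists>f. represents f (ratio ^ i)" for i
  proof (induction i)
    case 0
    have "represents (shift_pow 1) (of_int 1)"
      by (rule represents.shift[OF shift_pow_endos refl])
    then show ?case
      by auto
  next
    case (Suc i)
    then obtain g where g: "represents g (ratio ^ i)"
      by blast
    obtain f where "f \<in> endos" "\<And>y. y \<in> X \<Longrightarrow> f (fill y) = shift_pow 0 (fill (g y))"
      using endos_lift[OF represents_endos[OF g]] by blast
    then have "represents f (of_int 0 + ratio * ratio ^ i)"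
      unfolding ratio using g[unfolded ratio] by (rule_tac represents.lift)
    then show ?case
      by auto
  qed
  {
    case (incl h)
    then show ?case
      using pow by blast
  next
    case (inv h)
    then show ?case
      using pow represents_uminus unfolding inv_rat_add_group by blast
  }
next
  case (eng h1 h2)
  then obtain f1 f2 where "represents f1 h1" "represents f2 h2"
    by blast
  then have "represents (f1 \<circ> f2) (h1 + h2)"
    by (rule represents_comp)
  then show ?case
    by (auto simp: rat_add_group_def)
qed

lemma carrier_endo_monoid: "carrier (endo_monoid symbols X) = {f. f \<in> endos \<and> f \<in> extensional X}"
proof (intro equalityI subsetI)
  fix f
  assume "f \<in> carrier (endo_monoid symbols X)"
  then have f: "f \<in> X \<rightarrow>\<^sub>E X"
    "continuous_map (subtopology (full_shift symbols) X) (subtopology (full_shift symbols) X) f"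
    "\<And>x. x \<in> X \<Longrightarrow> f (shift x) = shift (f x)"
    by (auto simp: endo_monoid_def)
  then show "f \<in> {f. f \<in> endos \<and> f \<in> extensional X}"
    using continuous_imp_endos[OF _ f(2,3)] by (auto simp: PiE_iff)
next
  fix f
  assume "f \<in> {f. f \<in> endos \<and> f \<in> extensional X}"
  then have f: "f \<in> endos" "f \<in> extensional X"
    by auto
  have "f (shift x) = shift (f x)" if "x \<in> X" for x
    using endos_shift_pow[OF f(1) that, of 1] by (simp only: shift_pow_1)
  then show "f \<in> carrier (endo_monoid symbols X)"
    using f endos_in_X[OF f(1)] continuous_map_endos[OF f(1)]
    by (simp add: endo_monoid_def PiE_iff)
qed

lemma endo_monoid_iso: "endo_monoid symbols X \<cong> A_group (nat p) (nat q)"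
proof -
  define \<theta> where "\<theta> f = (THE r. represents f r)" for f
  have \<theta>: "\<theta> f = r" if "represents f r" for f r
    unfolding \<theta>_def using that represents_unique by blast
  have rep: "represents f (\<theta> f)" if "f \<in> carrier (endo_monoid symbols X)" for f
  proof -
    obtain r where "represents f r"
      using \<open>f \<in> _\<close> represents_exists by (auto simp: carrier_endo_monoid)
    then show ?thesis
      using \<theta> by simp
  qed
  have "\<theta> \<in> hom (endo_monoid symbols X) (A_group (nat p) (nat q))"
  proof (rule homI)
    show "\<theta> f \<in> carrier (A_group (nat p) (nat q))" if "f \<in> carrier (endo_monoid symbols X)" for f
      using rep[OF that] represents_A_group by blast
    fix f g
    assume fg: "f \<in> carrier (endo_monoid symbols X)" "g \<in> carrier (endo_monoid symbols X)"
    have "represents (f \<circ> g) (\<theta> f + \<theta> g)"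
      by (intro represents_comp rep fg)
    then have "represents (compose X f g) (\<theta> f + \<theta> g)"
      by (rule represents_cong) (simp add: compose_def)
    then have "\<theta> (compose X f g) = \<theta> f + \<theta> g"
      by (rule \<theta>)
    then show "\<theta> (f \<otimes>\<^bsub>endo_monoid symbols X\<^esub> g) = \<theta> f \<otimes>\<^bsub>A_group (nat p) (nat q)\<^esub> \<theta> g"
      by (simp add: endo_monoid_def A_group_def rat_add_group_def)
  qed
  moreover have "inj_on \<theta> (carrier (endo_monoid symbols X))"
  proof (rule inj_onI)
    fix f g
    assume f: "f \<in> carrier (endo_monoid symbols X)" and g: "g \<in> carrier (endo_monoid symbols X)"
      and eq: "\<theta> f = \<theta> g"
    have "f x = g x" if "x \<in> X" for x
      using represents_eq[OF rep[OF f] _ that] rep[OF g] eq by simp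
    then show "f = g"
      using f g by (auto simp: carrier_endo_monoid intro: extensionalityI)
  qed
  moreover have "\<theta> ` carrier (endo_monoid symbols X) = carrier (A_group (nat p) (nat q))"
  proof (intro equalityI subsetI)
    show "r \<in> carrier (A_group (nat p) (nat q))" if "r \<in> \<theta> ` carrier (endo_monoid symbols X)" for r
      using that rep represents_A_group by blast
    fix r
    assume "r \<in> carrier (A_group (nat p) (nat q))"
    then obtain f where "represents f r"
      using A_group_represents by blast
    \<comment> \<open>Restriction makes the map extensional without changing its
      translation.\<close>
    then have f: "represents (restrict f X) r"
      by (rule represents_cong) simp
    then have "restrict f X \<in> carrier (endo_monoid symbols X)"
      using represents_endos by (simp add: carrier_endo_monoid)
    then show "r \<in> \<theta> ` carrier (endo_monoid symbols X)"
      using \<theta>[OF f] by blast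
  qed
  ultimately show ?thesis
    unfolding is_iso_def iso_def bij_betw_def by blast
qed

end

theorem theorem3:
  fixes p p' q :: nat
  assumes "p = 2 * p' + 1" and "1 < q" and "q \<le> p'" and "gcd q p = 1" and "prime p"
  shows "\<exists>(S :: nat set) X. finite S \<and> toeplitz_subshift S X \<and> endo_monoid S X \<cong> A_group p q"
proof -
  have "coprime p q"
    using assms(4) by (simp add: coprime_iff_gcd_eq_1 gcd.commute)
  then have "coprime (int p) (int q)"
    by (simp only: coprime_int_iff)
  \<comment> \<open>\<open>p = 2 * p' + 1\<close> and \<open>q \<le> p'\<close> give
    \<open>2 * q < p\<close>, the room for \<open>q\<close> isolated holes in a block.\<close>
  then interpret toeplitz_pattern "int p" "int q"
    using assms(1-3) by unfold_locales linarith+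
  show ?thesis
    using toeplitz_subshift_X endo_monoid_iso by (metis finite_lessThan nat_int)
qed

end
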